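(* Let $\mathcal X=\{x^2y+z^2+x+t^3=0\}\subset\mathbb A^4_{\mathbb C}$, let $\widetilde P=x^2y+2xzu+z^2+x+t^3\in\mathbb C[x,y,z,t,u]$, and let $\mathcal Y=V(\widetilde P)\subset\mathbb A^5_{\mathbb C}$. Let $\tau,\delta_z,\delta_t,E$ be the four locally nilpotent $\mathbb C$-derivations of $\mathbb C[x,y,z,t,u]$ given by $$\tau=\frac{\partial}{\partial u}-x\frac{\partial}{\partial z}+2u\frac{\partial}{\partial y},\qquad \delta_z=x^2\frac{\partial}{\partial z}-2(z+xu)\frac{\partial}{\partial y},\qquad \delta_t=x^2\frac{\partial}{\partial t}-3t^2\frac{\partial}{\partial y},$$ and, with $a=1+xy+2zu$, $c=zy-2au$, $m=zy+2au$, $$E(x)=3t^2m,\quad E(y)=0,\quad E(z)=-3ayt^2,\quad E(t)=ac,\quad E(u)=-\tfrac32y^2t^2 .$$ Let $$G=\bigl\langle \exp(\lambda\partial)\ \big|\ \lambda\in\mathbb C,\ \partial\in\{\tau,\delta_z,\delta_t,E\}\bigr\rangle\subset\operatorname{Aut}(\mathbb A^5).$$ Then $G$ preserves $\mathcal Y$, and its induced action on $\mathcal Y$ is transitive. Consequently, $\mathcal X\times\mathbb A^1$ is flexible, and $\operatorname{SAut}(\mathcal X\times\mathbb A^1)$ acts infinitely transitively on $\mathcal X\times\mathbb A^1$.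
   Context: Everything is over $\mathbb C$; derivations are $\mathbb C$-derivations. For a locally nilpotent derivation $\partial$ of $\mathbb C[x,y,z,t,u]$ and $\lambda\in\mathbb C$, $\exp(\lambda\partial)$ denotes the automorphism of $\mathbb A^5$ sending a point $p$ to the point whose coordinates are $\sum_{k\ge0}\frac{\lambda^k}{k!}\partial^k(f)(p)$ for $f=x,y,z,t,u$. The threefold $\mathcal X$ is the Russell cubic threefold. The automorphism $\Theta(x,y,z,t,u)=(x,y+u^2,z-xu,t,u)$ of $\mathbb A^5$ restricts to an isomorphism $\mathcal X\times\mathbb A^1\to\mathcal Y$. For an affine variety $V$, $\operatorname{SAut}(V)$ is the subgroup of $\operatorname{Aut}(V)$ generated by all automorphisms arising from algebraic $\mathbb G_a$-actions on $V$. The (smooth) variety $V=\mathcal X\times\mathbb A^1$ is called flexible if at every point $q\in V$ the tangent space $T_qV$ is spanned by tangent vectors to orbits of algebraic $\mathbb G_a$-actions on $V$. A group acts infinitely transitively on $V$ if, for every integer $k\ge1$, it acts $k$-transitively, i.e. transitively on ordered $k$-tuples of pairwise distinct points of $V$. *)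

theory Defs
  imports
    "HOL-Analysis.Analysis"
    "HOL-Library.Poly_Mapping"
    "HOL-Algebra.Bij"
    "HOL-Algebra.Generated_Groups"
    "HOL-Algebra.Group_Action"
begin

section \<open>Polynomials over the complex numbers\<close>

text \<open>
  \<open>'n mpoly\<close> is the polynomial ring with one variable for each element of \<open>'n\<close>: the finitely
  supported functions from exponent vectors to coefficients, with the ring structure of
  \<^theory>\<open>HOL-Library.Poly_Mapping\<close>. Affine space with the same coordinates is \<open>complex ^ 'n\<close>.
\<close>

type_synonym 'n mpoly = "('n \<Rightarrow>\<^sub>0 nat) \<Rightarrow>\<^sub>0 complex"

definition Const :: "complex \<Rightarrow> 'n mpoly" where
  "Const c = Poly_Mapping.single 0 c"

definition Var :: "'n \<Rightarrow> 'n mpoly" where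
  "Var i = Poly_Mapping.single (Poly_Mapping.single i 1) 1"

definition peval :: "'n::finite mpoly \<Rightarrow> complex ^ 'n \<Rightarrow> complex" where
  "peval f p = (\<Sum>m\<in>Poly_Mapping.keys f.
     Poly_Mapping.lookup f m * (\<Prod>i\<in>UNIV. p $ i ^ Poly_Mapping.lookup m i))"

definition pdiff :: "'n \<Rightarrow> 'n mpoly \<Rightarrow> 'n mpoly" where
  "pdiff i f = (\<Sum>m\<in>Poly_Mapping.keys f.
     Poly_Mapping.single (m - Poly_Mapping.single i 1)
       (of_nat (Poly_Mapping.lookup m i) * Poly_Mapping.lookup f m))"

definition zero_set :: "'n::finite mpoly \<Rightarrow> (complex ^ 'n) set" where
  "zero_set f = {p. peval f p = 0}"


section \<open>Derivations and their exponentials\<close>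

definition C_derivation :: "('n mpoly \<Rightarrow> 'n mpoly) \<Rightarrow> bool" where
  "C_derivation D \<longleftrightarrow>
     (\<forall>f g. D (f + g) = D f + D g) \<and>
     (\<forall>c f. D (Const c * f) = Const c * D f) \<and>
     (\<forall>f g. D (f * g) = D f * g + f * D g)"

definition locally_nilpotent :: "('n mpoly \<Rightarrow> 'n mpoly) \<Rightarrow> bool" where
  "locally_nilpotent D \<longleftrightarrow> (\<forall>f. \<exists>k. (D ^^ k) f = 0)"

text \<open>The derivation taking the value \<open>a $ i\<close> on the \<open>i\<close>-th variable.\<close>

definition vfield :: "('n::finite mpoly) ^ 'n \<Rightarrow> 'n mpoly \<Rightarrow> 'n mpoly" where
  "vfield a f = (\<Sum>i\<in>UNIV. a $ i * pdiff i f)"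

lemma pdiff_Var: "pdiff i (Var j) = (if i = j then 1 else 0)"
  by (auto simp: pdiff_def Var_def lookup_single single_one)

lemma vfield_Var: "vfield a (Var j) = a $ j"
  by (simp add: vfield_def pdiff_Var if_distrib cong: if_cong)

text \<open>For locally nilpotent \<open>D\<close> only finitely many terms of the series are nonzero.\<close>

definition exp_map ::
  "complex \<Rightarrow> ('n::finite mpoly \<Rightarrow> 'n mpoly) \<Rightarrow> complex ^ 'n \<Rightarrow> complex ^ 'n" where
  "exp_map s D p = (\<chi> i. suminf (\<lambda>k. s ^ k / fact k * peval ((D ^^ k) (Var i)) p))"


section \<open>Automorphisms and actions of the additive group\<close>

text \<open>
  Below, a closed subvariety of affine space is given by its set \<open>V\<close> of points, and morphisms are
  maps of points that are restrictions of polynomial maps.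
\<close>

definition regular_on :: "(complex ^ 'n::finite) set \<Rightarrow> (complex ^ 'n \<Rightarrow> complex ^ 'm) \<Rightarrow> bool" where
  "regular_on V f \<longleftrightarrow> (\<exists>F :: 'n mpoly ^ 'm. \<forall>p\<in>V. \<forall>i. f p $ i = peval (F $ i) p)"

text \<open>
  As in \<^const>\<open>BijGroup\<close>, automorphisms of \<open>V\<close> are represented by functions that are
  \<^const>\<open>undefined\<close> outside \<open>V\<close>.
\<close>

definition aut_group :: "(complex ^ 'n::finite) set \<Rightarrow> (complex ^ 'n \<Rightarrow> complex ^ 'n) monoid" where
  "aut_group V = (BijGroup V)
     \<lparr>carrier := {f \<in> Bij V. regular_on V f \<and> regular_on V (inv_into V f)}\<rparr>"

text \<open>
  A morphism from the product of the affine line and \<open>V\<close> to \<open>V\<close> is given by polynomials in the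
  variables \<open>'n option\<close>, where \<^const>\<open>None\<close> is the coordinate of the affine line.
\<close>

definition Ga_action ::
  "(complex ^ 'n::finite) set \<Rightarrow> (complex \<Rightarrow> complex ^ 'n \<Rightarrow> complex ^ 'n) \<Rightarrow> bool" where
  "Ga_action V \<alpha> \<longleftrightarrow>
     (\<forall>s. \<forall>p\<in>V. \<alpha> s p \<in> V) \<and>
     (\<forall>p\<in>V. \<alpha> 0 p = p) \<and>
     (\<forall>s r. \<forall>p\<in>V. \<alpha> (s + r) p = \<alpha> s (\<alpha> r p)) \<and>
     (\<exists>F :: ('n option) mpoly ^ 'n. \<forall>s. \<forall>p\<in>V. \<forall>i.
        \<alpha> s p $ i = peval (F $ i) (\<chi> j. case j of None \<Rightarrow> s | Some l \<Rightarrow> p $ l))"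

definition SAut :: "(complex ^ 'n::finite) set \<Rightarrow> (complex ^ 'n \<Rightarrow> complex ^ 'n) set" where
  "SAut V = generate (aut_group V) {restrict (\<alpha> s) V | \<alpha> s. Ga_action V \<alpha>}"

definition exp_group ::
  "('n::finite mpoly \<Rightarrow> 'n mpoly) set \<Rightarrow> (complex ^ 'n \<Rightarrow> complex ^ 'n) set" where
  "exp_group \<D> = generate (aut_group UNIV) {exp_map s D | s D. D \<in> \<D>}"


section \<open>Flexibility and infinite transitivity\<close>

definition tangent_space :: "(complex ^ 'n::finite) set \<Rightarrow> complex ^ 'n \<Rightarrow> (complex ^ 'n) set" where
  "tangent_space V q =
     {v. \<forall>f. (\<forall>p\<in>V. peval f p = 0) \<longrightarrow> (\<Sum>i\<in>UNIV. peval (pdiff i f) q * v $ i) = 0}"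

definition orbit_tangents :: "(complex ^ 'n::finite) set \<Rightarrow> complex ^ 'n \<Rightarrow> (complex ^ 'n) set" where
  "orbit_tangents V q =
     {v. \<exists>\<alpha>. Ga_action V \<alpha> \<and>
         (\<forall>i. ((\<lambda>s. \<alpha> s q $ i) has_field_derivative v $ i) (at 0))}"

text \<open>\<^const>\<open>vec.span\<close> is the span over the field of scalars, here the complex numbers.\<close>

definition flexible :: "(complex ^ 'n::finite) set \<Rightarrow> bool" where
  "flexible V \<longleftrightarrow> (\<forall>q\<in>V. vec.span (orbit_tangents V q) = tangent_space V q)"

definition k_transitive :: "nat \<Rightarrow> ('a \<Rightarrow> 'a) set \<Rightarrow> 'a set \<Rightarrow> bool" where
  "k_transitive k H V \<longleftrightarrow>
     (\<forall>ps qs. length ps = k \<and> distinct ps \<and> set ps \<subseteq> V \<and>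
              length qs = k \<and> distinct qs \<and> set qs \<subseteq> V \<longrightarrow> (\<exists>g\<in>H. map g ps = qs))"

definition infinitely_transitive :: "('a \<Rightarrow> 'a) set \<Rightarrow> 'a set \<Rightarrow> bool" where
  "infinitely_transitive H V \<longleftrightarrow> (\<forall>k\<ge>1. k_transitive k H V)"


section \<open>The Russell cubic threefold and the hypersurface \<open>Y\<close>\<close>

text \<open>
  The coordinates \<open>x, y, z, t\<close> of affine 4-space are indexed by \<open>1, 2, 3, 4\<close>, and those of affine
  5-space, \<open>x, y, z, t, u\<close>, by \<open>1, 2, 3, 4, 5\<close>.
\<close>

definition russell_cubic :: "(complex ^ 4) set" where
  "russell_cubic = zero_set (Var 1 ^ 2 * Var 2 + Var 3 ^ 2 + Var 1 + Var 4 ^ 3)"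

definition times_A1 :: "(complex ^ 4) set \<Rightarrow> (complex ^ 5) set" where
  "times_A1 V = {p. vector [p $ 1, p $ 2, p $ 3, p $ 4] \<in> V}"

abbreviation vx :: "5 mpoly" where "vx \<equiv> Var 1"
abbreviation vy :: "5 mpoly" where "vy \<equiv> Var 2"
abbreviation vz :: "5 mpoly" where "vz \<equiv> Var 3"
abbreviation vt :: "5 mpoly" where "vt \<equiv> Var 4"
abbreviation vu :: "5 mpoly" where "vu \<equiv> Var 5"

definition P_tilde :: "5 mpoly" where
  "P_tilde = vx ^ 2 * vy + 2 * vx * vz * vu + vz ^ 2 + vx + vt ^ 3"

definition Y_hyp :: "(complex ^ 5) set" where
  "Y_hyp = zero_set P_tilde"

definition tau :: "5 mpoly \<Rightarrow> 5 mpoly" where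
  "tau = vfield (vector [0, 2 * vu, - vx, 0, 1])"

definition delta_z :: "5 mpoly \<Rightarrow> 5 mpoly" where
  "delta_z = vfield (vector [0, - 2 * (vz + vx * vu), vx ^ 2, 0, 0])"

definition delta_t :: "5 mpoly \<Rightarrow> 5 mpoly" where
  "delta_t = vfield (vector [0, - 3 * vt ^ 2, 0, vx ^ 2, 0])"

definition E_der :: "5 mpoly \<Rightarrow> 5 mpoly" where
  "E_der =
    (let a = 1 + vx * vy + 2 * vz * vu;
         c = vz * vy - 2 * a * vu;
         m = vz * vy + 2 * a * vu
     in vfield (vector [3 * vt ^ 2 * m, 0, - 3 * a * vy * vt ^ 2, a * c,
                        - Const (3 / 2) * vy ^ 2 * vt ^ 2]))"

lemma vector_5:
  "(vector [a, b, c, d, e] :: 'a::zero ^ 5) $ 1 = a"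
  "(vector [a, b, c, d, e] :: 'a::zero ^ 5) $ 2 = b"
  "(vector [a, b, c, d, e] :: 'a::zero ^ 5) $ 3 = c"
  "(vector [a, b, c, d, e] :: 'a::zero ^ 5) $ 4 = d"
  "(vector [a, b, c, d, e] :: 'a::zero ^ 5) $ 5 = e"
  by (simp_all add: vector_def)

lemma E_der_Var:
  defines "a \<equiv> 1 + vx * vy + 2 * vz * vu"
  shows "E_der vx = 3 * vt ^ 2 * (vz * vy + 2 * a * vu)"
    and "E_der vy = 0"
    and "E_der vz = - 3 * a * vy * vt ^ 2"
    and "E_der vt = a * (vz * vy - 2 * a * vu)"
    and "E_der vu = - Const (3 / 2) * vy ^ 2 * vt ^ 2"
  by (simp_all add: E_der_def Let_def vfield_Var vector_5 a_def algebra_simps)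

end

theory Submission
  imports Defs
begin

text \<open>
  On the open set \<open>x \<noteq> 0\<close> of \<open>Y\<close> the coordinates \<open>x, z, t, u\<close> are free and determine \<open>y\<close>. The flows of
  \<open>\<tau>\<close>, \<open>\<delta>\<^sub>z\<close>, \<open>\<delta>\<^sub>t\<close> fix \<open>x\<close> and translate \<open>u\<close>, \<open>z + xu\<close>, \<open>t\<close>, so for \<open>x \<noteq> 0\<close> every level set of \<open>x\<close> lies
  in one orbit (\<open>G_reaches_same_x\<close>). The derivation \<open>E\<close> connects these level sets. Its kernel contains
  \<open>y\<close>, \<open>a = 1 + xy + 2zu\<close> and \<open>c = zy - 2au\<close>, it acts on \<open>t\<close> as a translation by multiples of \<open>ac\<close>, and
  the equation of \<open>Y\<close>, multiplied by \<open>y\<^sup>2\<close>, reads \<open>a(a - 1)y + c\<^sup>2 + 2acu + y\<^sup>2t\<^sup>3 = 0\<close>. Hence if \<open>y, a, c\<close> are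
  nonzero then the orbit of \<open>E\<close> is parametrised by \<open>t\<close>, and \<open>x\<close> takes every complex value on it: this
  amounts to solving a quadratic equation for \<open>u\<close> and extracting a cube root for \<open>t\<close>
  (\<open>E_orbit_hits\<close>). Every point of \<open>Y\<close>, also with \<open>x = 0\<close>, can be moved to one with \<open>y, a, c\<close> nonzero
  (\<open>G_reaches_generic\<close>), which gives transitivity.

  Given transitivity, flexibility needs to be checked at a single point: polynomial automorphisms
  carry actions of the additive group to such actions, and their Jacobian matrices carry the tangents
  of orbits along. At a point where \<open>x \<noteq> 0\<close> and \<open>E(x) \<noteq> 0\<close> the four given vector fields already span
  a hyperplane.

  Infinite transitivity is obtained without general theory, by bringing every tuple of distinct
  points to one normal form. Multiplying the time of an action by a function that is constant on its
  orbits gives another action, a replica; by interpolation a replica moves finitely many points for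
  independent times, as soon as an invariant separates them (\<open>connects_independent_times\<close>). Polynomial
  conditions on the points that can be satisfied one at a time can be satisfied simultaneously
  (\<open>general_position\<close>), so one may assume that \<open>y, a, c\<close> are nonzero at all points and that \<open>y\<close>
  separates them. A replica of \<open>E\<close> with a factor in \<open>y\<close> then gives the points the \<open>x\<close>-coordinates
  \<open>1, 2, 3, \<dots>\<close>, and replicas of \<open>\<tau>\<close>, \<open>\<delta>\<^sub>z\<close>, \<open>\<delta>\<^sub>t\<close> with factors in \<open>x\<close> bring \<open>u, z, t\<close> to \<open>0\<close>
  (\<open>connects_normal_points\<close>). The isomorphism \<open>\<Theta>\<close> carries the result from \<open>Y\<close> to the cylinder.
\<close>

section \<open>The polynomial ring\<close>

lemma Const_0: "Const 0 = 0"
  by (simp add: Const_def)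

lemma Const_1: "Const 1 = 1"
  by (simp add: Const_def single_one)

lemma Const_mult: "Const (a * b) = Const a * Const b"
  by (simp add: Const_def mult_single)

lemma Const_uminus: "Const (- a) = - Const a"
  by (simp add: Const_def single_uminus)

lemma of_nat_eq_Const: "of_nat n = Const (of_nat n)"
  by (simp add: Const_def)

lemma numeral_eq_Const: "numeral n = Const (numeral n)"
  by (simp add: Const_def)

lemma single_eq_Const_mult: "Poly_Mapping.single m c = Const c * Poly_Mapping.single m 1"
  by (simp add: Const_def mult_single)

lemma sum_monomials:
  "f = (\<Sum>m\<in>Poly_Mapping.keys f. Poly_Mapping.single m (Poly_Mapping.lookup f m))"
  by (rule poly_mapping_eqI)
    (simp add: lookup_sum lookup_single when_def sum.delta in_keys_iff)

lemma single_sum_exponents: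
  "finite A \<Longrightarrow> Poly_Mapping.single (sum g A) (1::complex) = (\<Prod>i\<in>A. Poly_Mapping.single (g i) 1)"
proof (induction A rule: finite_induct)
  case (insert i A)
  then show ?case
    by (simp add: insert.IH[symmetric] mult_single)
qed (simp add: single_one)

lemma Var_power: "Var i ^ k = Poly_Mapping.single (Poly_Mapping.single i k) 1"
  by (induction k) (auto simp: Var_def single_one mult_single single_add[symmetric])

lemma monomial_eq_prod_Var:
  fixes m :: "'n::finite \<Rightarrow>\<^sub>0 nat"
  shows "Poly_Mapping.single m 1 = (\<Prod>i\<in>UNIV. Var i ^ Poly_Mapping.lookup m i)"
proof -
  have "m = (\<Sum>i\<in>UNIV. Poly_Mapping.single i (Poly_Mapping.lookup m i))"
    by (rule poly_mapping_eqI) (simp add: lookup_sum lookup_single when_def sum.delta)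
  then show ?thesis
    using single_sum_exponents[of UNIV "\<lambda>i. Poly_Mapping.single i (Poly_Mapping.lookup m i)"]
    by (simp add: Var_power)
qed

text \<open>
  Facts about all polynomials that are compatible with sums and products reduce to constants and
  variables; homomorphism and derivation arguments below take this form.
\<close>

lemma mpoly_induct [case_names Const Var add mult]:
  fixes f :: "'n::finite mpoly"
  assumes C: "\<And>c. Q (Const c)" and V: "\<And>i. Q (Var i)"
    and A: "\<And>f g. Q f \<Longrightarrow> Q g \<Longrightarrow> Q (f + g)"
    and M: "\<And>f g. Q f \<Longrightarrow> Q g \<Longrightarrow> Q (f * g)"
  shows "Q f"
proof -
  have pow: "Q (Var i ^ k)" for i k
    by (induction k) (use C[of 1] M V in \<open>auto simp: Const_1\<close>)
  have "Q (\<Prod>i\<in>S. Var i ^ Poly_Mapping.lookup m i)" if "finite S" for S and m :: "'n \<Rightarrow>\<^sub>0 nat"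
    using that by (induction S rule: finite_induct) (use C[of 1] M pow in \<open>auto simp: Const_1\<close>)
  then have mon: "Q (Poly_Mapping.single m c)" for m c
    by (subst single_eq_Const_mult) (auto simp: monomial_eq_prod_Var intro!: M C)
  have "Q (\<Sum>m\<in>S. Poly_Mapping.single m (Poly_Mapping.lookup f m))" if "finite S" for S
    using that by (induction S rule: finite_induct) (use C[of 0] A mon in \<open>auto simp: Const_0\<close>)
  then show ?thesis
    by (metis sum_monomials finite_keys)
qed

lemma monomial_induct [case_names single add]:
  fixes f :: "'n mpoly"
  assumes "\<And>m c. Q (Poly_Mapping.single m c)"
    and "\<And>f g. Q f \<Longrightarrow> Q g \<Longrightarrow> Q (f + g)"
  shows "Q f"
proof -
  have "Q (\<Sum>m\<in>S. Poly_Mapping.single m (Poly_Mapping.lookup f m))" if "finite S" for S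
    using that by (induction S rule: finite_induct) (use assms assms(1)[of 0 0] in auto)
  then show ?thesis
    by (metis sum_monomials finite_keys)
qed

lemma sum_keys_mono:
  assumes "finite S" "Poly_Mapping.keys f \<subseteq> S" "\<And>m. h m 0 = 0"
  shows "(\<Sum>m\<in>Poly_Mapping.keys f. h m (Poly_Mapping.lookup f m)) =
    (\<Sum>m\<in>S. h m (Poly_Mapping.lookup f m))"
  by (rule sum.mono_neutral_left) (use assms in \<open>auto simp: in_keys_iff\<close>)

lemma sum_keys_add:
  assumes "\<And>m. h m 0 = 0" "\<And>m a b. h m (a + b) = h m a + h m b"
  shows "(\<Sum>m\<in>Poly_Mapping.keys (f + g). h m (Poly_Mapping.lookup (f + g) m)) =
    (\<Sum>m\<in>Poly_Mapping.keys f. h m (Poly_Mapping.lookup f m)) +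
    (\<Sum>m\<in>Poly_Mapping.keys g. h m (Poly_Mapping.lookup g m))"
proof -
  let ?S = "Poly_Mapping.keys f \<union> Poly_Mapping.keys g"
  have k: "Poly_Mapping.keys (f + g) \<subseteq> ?S"
    by (rule keys_add)
  show ?thesis
    using sum_keys_mono[of ?S "f + g" h, OF _ k assms(1)] sum_keys_mono[of ?S f h]
      sum_keys_mono[of ?S g h] assms
    by (simp add: lookup_add sum.distrib)
qed

lemma peval_add: "peval (f + g) p = peval f p + peval g p"
  unfolding peval_def
  by (rule sum_keys_add[where h = "\<lambda>m c. c * (\<Prod>i\<in>UNIV. p $ i ^ Poly_Mapping.lookup m i)"])
    (auto simp: algebra_simps)

lemma peval_single:
  "peval (Poly_Mapping.single m c) p = c * (\<Prod>i\<in>UNIV. p $ i ^ Poly_Mapping.lookup m i)"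
  by (simp add: peval_def)

lemma peval_mult: "peval (f * g) p = peval f p * peval g p"
proof (induction f rule: monomial_induct)
  case f: (single m c)
  show ?case
    by (induction g rule: monomial_induct)
      (simp_all add: mult_single peval_single lookup_add power_add prod.distrib peval_add
        algebra_simps)
qed (simp add: peval_add algebra_simps)

lemma peval_Const: "peval (Const c) p = c"
  by (simp add: Const_def peval_single)

lemma peval_Var: "peval (Var i) p = p $ i"
proof -
  have "(\<Prod>j\<in>UNIV. p $ j ^ Poly_Mapping.lookup (Poly_Mapping.single i 1) j) =
      (\<Prod>j\<in>UNIV. if i = j then p $ j else 1)"
    by (rule prod.cong) (auto simp: lookup_single when_def)
  then show ?thesis
    by (simp add: Var_def peval_single)
qed

lemma peval_0: "peval 0 p = 0"
  using peval_Const[of 0] by (simp add: Const_0)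

lemma peval_1: "peval 1 p = 1"
  using peval_Const[of 1] by (simp add: Const_1)

lemma peval_numeral: "peval (numeral n) p = numeral n"
  by (simp add: numeral_eq_Const peval_Const)

lemma peval_of_nat: "peval (of_nat n) p = of_nat n"
  by (simp add: of_nat_eq_Const peval_Const)

lemma peval_uminus: "peval (- f) p = - peval f p"
  using peval_add[of f "- f" p] by (simp add: peval_0 eq_neg_iff_add_eq_0 add.commute)

lemma peval_diff: "peval (f - g) p = peval f p - peval g p"
  using peval_add[of f "- g" p] by (simp add: peval_uminus)

lemma peval_power: "peval (f ^ k) p = peval f p ^ k"
  by (induction k) (auto simp: peval_1 peval_mult)

lemma peval_sum: "peval (sum h S) p = (\<Sum>j\<in>S. peval (h j) p)"
  by (induction S rule: infinite_finite_induct) (auto simp: peval_0 peval_add)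

lemmas peval_simps = peval_add peval_mult peval_Const peval_Var peval_0 peval_1 peval_numeral
  peval_of_nat peval_uminus peval_diff peval_power peval_sum

lemma pdiff_add: "pdiff i (f + g) = pdiff i f + pdiff i g"
  unfolding pdiff_def
  by (rule sum_keys_add[where h = "\<lambda>m c. Poly_Mapping.single (m - Poly_Mapping.single i 1)
        (of_nat (Poly_Mapping.lookup m i) * c)"])
    (auto simp: algebra_simps single_add)

lemma pdiff_single: "pdiff i (Poly_Mapping.single m c) =
    Poly_Mapping.single (m - Poly_Mapping.single i 1) (of_nat (Poly_Mapping.lookup m i) * c)"
  by (simp add: pdiff_def)

lemma pdiff_Const: "pdiff i (Const c) = 0"
  by (simp add: Const_def pdiff_single)

text \<open>
  The exponent vectors are subtracted with truncation, so the product rule on monomials needs the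
  shift to be moved out of a factor only when that factor contains the variable; otherwise the
  coefficient is zero.
\<close>

lemma pdiff_mult: "pdiff i (f * g) = pdiff i f * g + f * pdiff i g"
proof (induction f rule: monomial_induct)
  case f: (single m c)
  show ?case
  proof (induction g rule: monomial_induct)
    case (single n d)
    let ?e = "Poly_Mapping.single i (1::nat)"
    have shift: "Poly_Mapping.single (k - ?e + l) (of_nat (Poly_Mapping.lookup k i) * a) =
        Poly_Mapping.single (k + l - ?e) (of_nat (Poly_Mapping.lookup k i) * a)"
      for k l :: "'a \<Rightarrow>\<^sub>0 nat" and a :: complex
    proof (cases "Poly_Mapping.lookup k i = 0")
      case False
      then have "k - ?e + l = k + l - ?e"
        by (intro poly_mapping_eqI) (auto simp: lookup_add lookup_minus lookup_single when_def)
      then show ?thesis by simp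
    qed simp
    show ?case
      using shift[of m n "c * d"] shift[of n m "c * d"]
      by (simp add: mult_single pdiff_single lookup_add algebra_simps single_add)
  qed (simp add: pdiff_add algebra_simps)
qed (simp add: pdiff_add algebra_simps)

section \<open>Polynomial functions\<close>

text \<open>
  Working with the functions rather than with the polynomials that represent them avoids every
  explicit construction of substituted polynomials, in particular across the change of variables from
  \<open>'n\<close> to \<open>'n option\<close>.
\<close>

definition poly_fun :: "(complex ^ 'n::finite \<Rightarrow> complex) \<Rightarrow> bool" where
  "poly_fun h \<longleftrightarrow> (\<exists>F. \<forall>p. h p = peval F p)"

lemma poly_fun_peval: "poly_fun (peval F)"
  by (auto simp: poly_fun_def)

lemma poly_fun_const: "poly_fun (\<lambda>_. c)"
  unfolding poly_fun_def by (metis peval_Const)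

lemma poly_fun_coord: "poly_fun (\<lambda>p. p $ i)"
  unfolding poly_fun_def by (metis peval_Var)

lemma poly_fun_add: "poly_fun f \<Longrightarrow> poly_fun g \<Longrightarrow> poly_fun (\<lambda>p. f p + g p)"
  unfolding poly_fun_def by (metis peval_add)

lemma poly_fun_mult: "poly_fun f \<Longrightarrow> poly_fun g \<Longrightarrow> poly_fun (\<lambda>p. f p * g p)"
  unfolding poly_fun_def by (metis peval_mult)

lemma poly_fun_diff: "poly_fun f \<Longrightarrow> poly_fun g \<Longrightarrow> poly_fun (\<lambda>p. f p - g p)"
  unfolding poly_fun_def by (metis peval_diff)

lemma poly_fun_power: "poly_fun f \<Longrightarrow> poly_fun (\<lambda>p. f p ^ k)"
  unfolding poly_fun_def by (metis peval_power)

lemma poly_fun_divide_const: "poly_fun f \<Longrightarrow> poly_fun (\<lambda>p. f p / c)"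
  using poly_fun_mult[OF _ poly_fun_const[of "inverse c"]] by (simp add: field_simps)

lemma poly_fun_sum: "(\<And>j. j \<in> S \<Longrightarrow> poly_fun (f j)) \<Longrightarrow> poly_fun (\<lambda>p. \<Sum>j\<in>S. f j p)"
  by (induction S rule: infinite_finite_induct) (auto intro: poly_fun_const poly_fun_add)

lemma poly_fun_compose:
  assumes "poly_fun h" and "\<And>i. poly_fun (\<lambda>p. k p $ i)"
  shows "poly_fun (\<lambda>p. h (k p))"
proof -
  have "poly_fun (\<lambda>p. peval F (k p))" for F
    by (induction F rule: mpoly_induct)
      (auto simp: peval_simps intro: assms poly_fun_const poly_fun_add poly_fun_mult)
  then show ?thesis
    using assms(1) by (auto simp: poly_fun_def[of h])
qed

lemma poly_fun_poly: "poly_fun h \<Longrightarrow> poly_fun (\<lambda>p. poly Q (h p))"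
  by (induction Q) (auto intro: poly_fun_const poly_fun_add poly_fun_mult)

lemmas poly_fun_intros = poly_fun_peval poly_fun_const poly_fun_coord poly_fun_add poly_fun_mult
  poly_fun_diff poly_fun_power poly_fun_divide_const poly_fun_sum poly_fun_poly

lemma regular_on_iff: "regular_on V f \<longleftrightarrow> (\<exists>k. (\<forall>i. poly_fun (\<lambda>p. k p $ i)) \<and> (\<forall>p\<in>V. f p = k p))"
proof
  assume "regular_on V f"
  then obtain F where F: "\<And>p i. p \<in> V \<Longrightarrow> f p $ i = peval (F $ i) p"
    by (auto simp: regular_on_def)
  show "\<exists>k. (\<forall>i. poly_fun (\<lambda>p. k p $ i)) \<and> (\<forall>p\<in>V. f p = k p)"
    by (rule exI[of _ "\<lambda>p. \<chi> i. peval (F $ i) p"])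
      (auto simp: F vec_eq_iff intro: poly_fun_peval)
next
  assume "\<exists>k. (\<forall>i. poly_fun (\<lambda>p. k p $ i)) \<and> (\<forall>p\<in>V. f p = k p)"
  then obtain k F where k: "\<And>i p. k p $ i = peval (F i) p" "\<forall>p\<in>V. f p = k p"
    unfolding poly_fun_def by metis
  show "regular_on V f"
    unfolding regular_on_def by (rule exI[of _ "\<chi> i. F i"]) (auto simp: k)
qed

definition opt_point :: "complex \<Rightarrow> complex ^ 'n \<Rightarrow> complex ^ 'n option" where
  "opt_point s p = (\<chi> j. case j of None \<Rightarrow> s | Some l \<Rightarrow> p $ l)"

lemma opt_point_nth: "opt_point s p $ None = s" "opt_point s p $ Some l = p $ l"
  by (simp_all add: opt_point_def)

definition poly_fun2 :: "(complex \<Rightarrow> complex ^ 'n::finite \<Rightarrow> complex) \<Rightarrow> bool" where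
  "poly_fun2 h \<longleftrightarrow> (\<exists>H. poly_fun H \<and> (\<forall>s p. h s p = H (opt_point s p)))"

lemma poly_fun2I:
  assumes "poly_fun (\<lambda>r. h (r $ None) (\<chi> l. r $ Some l))"
  shows "poly_fun2 h"
  unfolding poly_fun2_def
  by (rule exI, rule conjI, rule assms) (simp add: opt_point_nth vec_lambda_eta)

lemma poly_fun2_subst:
  assumes "poly_fun2 h" "poly_fun a" "\<And>i. poly_fun (\<lambda>q. b q $ i)"
  shows "poly_fun (\<lambda>q. h (a q) (b q))"
proof -
  obtain H where H: "poly_fun H" "\<And>s p. h s p = H (opt_point s p)"
    using assms(1) by (auto simp: poly_fun2_def)
  have "poly_fun (\<lambda>q. opt_point (a q) (b q) $ i)" for i
    using assms(2,3) by (cases i) (auto simp: opt_point_nth)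
  then show ?thesis
    unfolding H(2) by (rule poly_fun_compose[OF H(1)])
qed

lemma poly_fun_of_param: "poly_fun (\<lambda>r. (\<chi> l. r $ Some l) $ i)"
  by (simp add: poly_fun_coord)

lemma poly_fun2_compose:
  assumes "poly_fun2 h" "poly_fun2 a" "\<And>i. poly_fun2 (\<lambda>s p. b s p $ i)"
  shows "poly_fun2 (\<lambda>s p. h (a s p) (b s p))"
  by (rule poly_fun2I, rule poly_fun2_subst[OF assms(1)])
    (rule poly_fun2_subst[OF assms(2)] poly_fun2_subst[OF assms(3)], auto intro: poly_fun_coord)+

lemma poly_fun2_param: "poly_fun2 (\<lambda>s p. s)"
  by (rule poly_fun2I) (rule poly_fun_coord)

lemma poly_fun2_point:
  assumes "poly_fun h"
  shows "poly_fun2 (\<lambda>s p. h p)"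
  by (rule poly_fun2I, rule poly_fun_compose[OF assms]) (rule poly_fun_of_param)

lemma poly_fun2_mult: "poly_fun2 f \<Longrightarrow> poly_fun2 g \<Longrightarrow> poly_fun2 (\<lambda>s p. f s p * g s p)"
  unfolding poly_fun2_def
  by (elim exE conjE, rule_tac x = "\<lambda>r. H r * Ha r" in exI) (auto intro: poly_fun_mult)

lemma peval_poly_curve:
  assumes "\<And>i. \<exists>Q. \<forall>s. v s $ i = poly Q s"
  shows "\<exists>Q. \<forall>s. peval F (v s) = poly Q s"
proof (induction F rule: mpoly_induct)
  case (Const c)
  show ?case by (rule exI[of _ "[:c:]"]) (simp add: peval_Const)
next
  case (Var i)
  show ?case using assms by (simp add: peval_Var)
next
  case (add f g)
  then show ?case by (metis peval_add poly_add)
next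
  case (mult f g)
  then show ?case by (metis peval_mult poly_mult)
qed

lemma poly_fun_poly_curve:
  assumes "poly_fun h" "\<And>i. \<exists>Q. \<forall>s. v s $ i = poly Q s"
  shows "\<exists>Q. \<forall>s. h (v s) = poly Q s"
  using assms(1) peval_poly_curve[OF assms(2)] unfolding poly_fun_def by metis

text \<open>
  The chain rule, which links the algebraic definition of tangent spaces through formal partial
  derivatives with the analytic derivatives of orbits.
\<close>

lemma peval_has_field_derivative_curve:
  fixes v :: "complex ^ 'n::finite"
  assumes "\<And>i. ((\<lambda>s. k s $ i) has_field_derivative v $ i) (at a)"
  shows "((\<lambda>s. peval f (k s)) has_field_derivative
    (\<Sum>i\<in>UNIV. peval (pdiff i f) (k a) * v $ i)) (at a)"
proof (induction f rule: mpoly_induct)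
  case (Var j)
  have "(\<Sum>i\<in>UNIV. peval (pdiff i (Var j)) (k a) * v $ i) = (\<Sum>i\<in>UNIV. if i = j then v $ i else 0)"
    by (rule sum.cong) (auto simp: pdiff_Var peval_simps)
  then show ?case
    using assms[of j] by (simp add: peval_Var)
next
  case (add f g)
  then show ?case
    using DERIV_add[OF add] by (simp add: peval_add pdiff_add sum.distrib algebra_simps)
next
  case (mult f g)
  then show ?case
    using DERIV_mult[OF mult]
    by (simp add: peval_add peval_mult pdiff_mult sum.distrib algebra_simps sum_distrib_left)
qed (simp add: peval_Const pdiff_Const peval_0)

section \<open>Derivations\<close>

locale C_deriv =
  fixes D :: "'n::finite mpoly \<Rightarrow> 'n mpoly"
  assumes C_derivation: "C_derivation D"
begin

lemma add: "D (f + g) = D f + D g"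
  and Const_mult: "D (Const c * f) = Const c * D f"
  and mult: "D (f * g) = D f * g + f * D g"
  using C_derivation unfolding C_derivation_def by blast+

lemma one: "D 1 = 0"
  using mult[of 1 1] by simp

lemma Const: "D (Const c) = 0"
  using Const_mult[of c 1] by (simp add: one)

lemma zero: "D 0 = 0"
  using Const[of 0] by (simp add: Const_0)

lemma numeral: "D (numeral n) = 0"
  by (simp add: numeral_eq_Const Const)

lemma uminus: "D (- f) = - D f"
  using add[of f "- f"] by (simp add: zero eq_neg_iff_add_eq_0 add.commute)

lemma diff: "D (f - g) = D f - D g"
  using add[of f "- g"] by (simp add: uminus)

lemma power2: "D (f ^ 2) = 2 * f * D f"
  by (simp add: power2_eq_square mult algebra_simps)

lemma power3: "D (f ^ 3) = 3 * f ^ 2 * D f"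
  by (simp add: power3_eq_cube power2_eq_square mult algebra_simps)

lemmas rules = add mult one Const zero numeral uminus diff power2 power3

lemma iter_add: "(D ^^ k) (f + g) = (D ^^ k) f + (D ^^ k) g"
  by (induction k) (auto simp: add)

lemma iter_zero: "(D ^^ k) 0 = 0"
  by (induction k) (auto simp: zero)

lemma iter_Const: "(D ^^ Suc k) (Const c) = 0"
  by (simp only: funpow_Suc_right o_apply Const iter_zero)

lemma iter_eq_0_mono: "(D ^^ k) f = 0 \<Longrightarrow> k \<le> n \<Longrightarrow> (D ^^ n) f = 0"
  by (metis iter_zero funpow_add o_apply le_add_diff_inverse2)

lemma Leibniz:
  "(D ^^ n) (f * g) = (\<Sum>k\<le>n. of_nat (n choose k) * (D ^^ k) f * (D ^^ (n - k)) g)"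
proof (induction n arbitrary: f g)
  case (Suc n)
  let ?h = "\<lambda>k l. (D ^^ k) f * (D ^^ l) g"
  have "(D ^^ Suc n) (f * g) = (D ^^ n) (D f * g) + (D ^^ n) (f * D g)"
    by (simp only: funpow_Suc_right o_apply mult iter_add)
  also have "\<dots> = (\<Sum>k\<le>n. of_nat (n choose k) * ?h (Suc k) (n - k)) +
      (\<Sum>k\<le>n. of_nat (n choose k) * ?h k (Suc (n - k)))"
    by (simp only: Suc.IH funpow_Suc_right o_apply mult.assoc)
  also have "(\<Sum>k\<le>n. of_nat (n choose k) * ?h k (Suc (n - k))) =
      (\<Sum>k\<le>Suc n. of_nat (n choose k) * ?h k (Suc n - k))"
    by (simp add: Suc_diff_le binomial_eq_0)
  also have "\<dots> = ?h 0 (Suc n) + (\<Sum>k\<le>n. of_nat (n choose Suc k) * ?h (Suc k) (n - k))"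
    by (simp only: sum.atMost_Suc_shift) simp
  also have "(\<Sum>k\<le>n. of_nat (n choose k) * ?h (Suc k) (n - k)) + \<dots> =
      ?h 0 (Suc n) + (\<Sum>k\<le>n. of_nat (Suc n choose Suc k) * ?h (Suc k) (n - k))"
    by (simp add: sum.distrib algebra_simps del: funpow.simps)
  also have "\<dots> = (\<Sum>k\<le>Suc n. of_nat (Suc n choose k) * ?h k (Suc n - k))"
    by (simp only: sum.atMost_Suc_shift) simp
  finally show ?case
    by (simp only: mult.assoc)
qed simp

text \<open>
  The nilpotent elements form a subalgebra that contains every element whose derivative it contains.
  So local nilpotency follows from a triangular pattern in the values on the variables, without
  computing any iterates.
\<close>

definition nilp :: "'n mpoly \<Rightarrow> bool" where
  "nilp f \<longleftrightarrow> (\<exists>k. (D ^^ k) f = 0)"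

lemma nilp_D: "nilp (D f) \<Longrightarrow> nilp f"
  unfolding nilp_def by (metis funpow_Suc_right o_apply)

lemma nilp_Const: "nilp (Const c)"
  unfolding nilp_def using iter_Const by blast

lemma nilp_add: "nilp f \<Longrightarrow> nilp g \<Longrightarrow> nilp (f + g)"
proof -
  assume "nilp f" "nilp g"
  then obtain k l where "(D ^^ k) f = 0" "(D ^^ l) g = 0"
    by (auto simp: nilp_def)
  then have "(D ^^ (k + l)) (f + g) = 0"
    using iter_eq_0_mono[of k f "k + l"] iter_eq_0_mono[of l g "k + l"] by (simp add: iter_add)
  then show ?thesis
    unfolding nilp_def by blast
qed

lemma nilp_mult: assumes "nilp f" "nilp g" shows "nilp (f * g)"
proof -
  obtain k l where kl: "(D ^^ k) f = 0" "(D ^^ l) g = 0"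
    using assms by (auto simp: nilp_def)
  have "(D ^^ i) f = 0 \<or> (D ^^ (k + l - i)) g = 0" for i
    using iter_eq_0_mono[OF kl(1), of i] iter_eq_0_mono[OF kl(2), of "k + l - i"] by fastforce
  then have "(D ^^ (k + l)) (f * g) = 0"
    unfolding Leibniz by (intro sum.neutral) (metis mult_zero_left mult_zero_right)
  then show ?thesis
    by (auto simp: nilp_def)
qed

lemma nilp_kernel: "D f = 0 \<Longrightarrow> nilp f"
  by (rule nilp_D) (metis nilp_Const Const_0)

lemma nilp_numeral: "nilp (numeral n)" and nilp_one: "nilp 1"
  by (auto intro: nilp_kernel numeral one)

lemma nilp_uminus: "nilp f \<Longrightarrow> nilp (- f)"
  using nilp_mult[OF nilp_Const, of f "-1"] by (simp add: Const_uminus Const_1)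

lemma nilp_diff: "nilp f \<Longrightarrow> nilp g \<Longrightarrow> nilp (f - g)"
  using nilp_add[OF _ nilp_uminus, of f g] by simp

lemma nilp_power: "nilp f \<Longrightarrow> nilp (f ^ k)"
  by (induction k) (auto intro: nilp_one nilp_mult)

lemmas nilp_intros = nilp_Const nilp_numeral nilp_one nilp_uminus nilp_diff nilp_power nilp_add
  nilp_mult

lemma locally_nilpotentI:
  assumes "\<And>i. nilp (Var i)"
  shows "locally_nilpotent D"
proof -
  have "nilp f" for f
    by (induction f rule: mpoly_induct) (auto intro: assms nilp_intros)
  then show ?thesis
    by (simp add: locally_nilpotent_def nilp_def)
qed

end

lemma C_deriv_vfield: "C_deriv (vfield a)"
proof
  have "pdiff i (Const c * f) = Const c * pdiff i f" for i c f
    by (simp add: pdiff_mult pdiff_Const)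
  then show "C_derivation (vfield a)"
    unfolding C_derivation_def vfield_def
    by (auto simp: pdiff_add pdiff_mult pdiff_Const algebra_simps sum.distrib sum_distrib_left)
qed

section \<open>Exponentials of locally nilpotent derivations\<close>

locale lnd = C_deriv D for D :: "'n::finite mpoly \<Rightarrow> 'n mpoly" +
  assumes locally_nilpotent: "locally_nilpotent D"
begin

definition exp_series :: "complex \<Rightarrow> 'n mpoly \<Rightarrow> complex ^ 'n \<Rightarrow> complex" where
  "exp_series s f p = suminf (\<lambda>k. s ^ k / fact k * peval ((D ^^ k) f) p)"

lemma nilpotent: obtains N where "(D ^^ N) f = 0"
  using locally_nilpotent by (auto simp: locally_nilpotent_def)

lemma exp_series_finite:
  "(D ^^ N) f = 0 \<Longrightarrow> exp_series s f p = (\<Sum>k<N. s ^ k / fact k * peval ((D ^^ k) f) p)"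
  unfolding exp_series_def by (rule suminf_finite) (auto simp: iter_eq_0_mono peval_0 not_less)

lemma summable_terms: "summable (\<lambda>k. norm (s ^ k / fact k * peval ((D ^^ k) f) p))"
proof -
  obtain N where N: "(D ^^ N) f = 0" by (rule nilpotent)
  show ?thesis
    by (rule summable_finite[of "{..<N}"]) (auto simp: iter_eq_0_mono[OF N] peval_0 not_less)
qed

lemma exp_series_Const: "exp_series s (Const c) p = c"
  using exp_series_finite[of 1 "Const c" s p] by (simp add: Const peval_Const)

lemma exp_series_add: "exp_series s (f + g) p = exp_series s f p + exp_series s g p"
  unfolding exp_series_def
  by (subst suminf_add[OF summable_norm_cancel[OF summable_terms] summable_norm_cancel[OF summable_terms]])
    (simp add: iter_add peval_add algebra_simps)

text \<open>
  By the Leibniz rule, the divided powers of the derivation of a product are the Cauchy product of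
  those of the factors. So evaluating the exponential series at a point is a ring homomorphism.
\<close>

lemma exp_series_mult: "exp_series s (f * g) p = exp_series s f p * exp_series s g p"
proof -
  have "s ^ n / fact n * peval ((D ^^ n) (f * g)) p =
      (\<Sum>i\<le>n. (s ^ i / fact i * peval ((D ^^ i) f) p) *
        (s ^ (n - i) / fact (n - i) * peval ((D ^^ (n - i)) g) p))" for n
  proof -
    have "s ^ n / fact n * (of_nat (n choose i) * a * b) =
        (s ^ i / fact i * a) * (s ^ (n - i) / fact (n - i) * b)" if "i \<le> n" for i a b
    proof -
      have "s ^ n = s ^ i * s ^ (n - i)"
        using that by (simp flip: power_add)
      then show ?thesis
        using that by (simp add: binomial_fact field_simps)
    qed
    then show ?thesis
      unfolding Leibniz peval_sum sum_distrib_left peval_mult peval_of_nat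
      by (intro sum.cong) (auto simp: mult.assoc)
  qed
  then show ?thesis
    unfolding exp_series_def by (subst Cauchy_product[OF summable_terms summable_terms]) simp
qed

lemma exp_map_nth: "exp_map s D p $ i = exp_series s (Var i) p"
  by (simp add: exp_map_def exp_series_def)

text \<open>
  Both sides are ring homomorphisms in \<open>f\<close> that agree on the variables. Consequently elements of the
  kernel of the derivation are invariants of the flow.
\<close>

lemma peval_exp_map: "peval f (exp_map s D p) = exp_series s f p"
  by (induction f rule: mpoly_induct)
    (simp_all add: peval_simps exp_map_nth exp_series_Const exp_series_add exp_series_mult)

lemma peval_exp_map_kernel: "D f = 0 \<Longrightarrow> peval f (exp_map s D p) = peval f p"
  using exp_series_finite[of 1 f s p] by (simp add: peval_exp_map)

lemma peval_exp_map_slice: "D (D f) = 0 \<Longrightarrow> peval f (exp_map s D p) = peval f p + s * peval (D f) p"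
  using exp_series_finite[of 2 f s p] by (simp add: peval_exp_map eval_nat_numeral)

lemma exp_map_0: "exp_map 0 D p = p"
proof -
  have "exp_series 0 f p = peval f p" for f
  proof -
    have "exp_series 0 f p = (\<Sum>k\<in>{0}. 0 ^ k / fact k * peval ((D ^^ k) f) p)"
      unfolding exp_series_def by (rule suminf_finite) auto
    then show ?thesis by simp
  qed
  then show ?thesis
    by (simp add: vec_eq_iff exp_map_nth peval_Var)
qed

text \<open>
  The coefficient of \<open>D ^^ n\<close> in the double series is \<open>(s + r) ^ n / fact n\<close> by the binomial theorem.
\<close>

lemma exp_map_add: "exp_map (s + r) D p = exp_map s D (exp_map r D p)"
proof -
  have "exp_series (s + r) f p = exp_series s f (exp_map r D p)" for f
  proof -
    obtain N where N: "(D ^^ N) f = 0" by (rule nilpotent)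
    define h where "h n = peval ((D ^^ n) f) p" for n
    have h0: "h n = 0" if "N \<le> n" for n
      using iter_eq_0_mono[OF N that] by (simp add: h_def peval_0)
    then have hN: "n < N" if "h n \<noteq> 0" for n
      using that not_less by blast
    let ?w = "\<lambda>k l. s ^ k / fact k * (r ^ l / fact l * h (k + l))"
    have "exp_series s f (exp_map r D p) = (\<Sum>k<N. \<Sum>l<N. ?w k l)"
    proof -
      have "peval ((D ^^ k) f) (exp_map r D p) = (\<Sum>l<N. r ^ l / fact l * h (k + l))" for k
      proof -
        have "(D ^^ N) ((D ^^ k) f) = 0"
          using iter_eq_0_mono[OF N, of "N + k"] by (simp add: funpow_add)
        moreover have "(D ^^ l) ((D ^^ k) f) = (D ^^ (k + l)) f" for l
          by (simp add: funpow_add[symmetric, THEN fun_cong, simplified] add.commute)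
        ultimately show ?thesis
          by (simp add: peval_exp_map exp_series_finite h_def)
      qed
      then show ?thesis
        by (simp add: exp_series_finite[OF N] sum_distrib_left)
    qed
    also have "\<dots> = (\<Sum>(k, l)\<in>{..<N} \<times> {..<N}. ?w k l)"
      by (simp add: sum.cartesian_product)
    also have "\<dots> = (\<Sum>(k, l)\<in>{(k, l). k + l < N}. ?w k l)"
      by (rule sum.mono_neutral_right) (auto intro: hN)
    also have "\<dots> = (\<Sum>n<N. \<Sum>k\<le>n. ?w k (n - k))"
      by (rule sum.triangle_reindex)
    also have "\<dots> = (\<Sum>n<N. (s + r) ^ n / fact n * h n)"
    proof (rule sum.cong[OF refl])
      fix n
      have "?w k (n - k) = of_nat (n choose k) * s ^ k * r ^ (n - k) / fact n * h n" if "k \<le> n" for k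
        using that by (simp add: binomial_fact field_simps)
      then show "(\<Sum>k\<le>n. ?w k (n - k)) = (s + r) ^ n / fact n * h n"
        by (simp add: binomial_ring sum_distrib_right sum_divide_distrib)
    qed
    also have "\<dots> = exp_series (s + r) f p"
      by (simp add: exp_series_finite[OF N] h_def)
    finally show ?thesis by simp
  qed
  then show ?thesis
    by (simp add: vec_eq_iff exp_map_nth)
qed

lemma poly_fun2_exp_map: "poly_fun2 (\<lambda>s p. exp_map s D p $ i)"
proof -
  obtain N where N: "(D ^^ N) (Var i) = 0" by (rule nilpotent)
  show ?thesis
    unfolding exp_map_nth exp_series_finite[OF N]
    by (rule poly_fun2I)
      (intro poly_fun_sum poly_fun_mult poly_fun_divide_const poly_fun_power poly_fun_coord
        poly_fun_compose[OF poly_fun_peval] poly_fun_of_param)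
qed

lemma exp_map_has_field_derivative:
  "((\<lambda>s. exp_map s D p $ i) has_field_derivative peval (D (Var i)) p) (at 0)"
proof -
  obtain N where N: "(D ^^ N) (Var i) = 0" by (rule nilpotent)
  then have N2: "(D ^^ (N + 2)) (Var i) = 0"
    by (rule iter_eq_0_mono) simp
  define h where "h k = peval ((D ^^ k) (Var i)) p / fact k" for k
  have split: "{..<N + 2} = insert 0 (insert 1 {2..<N + 2})"
    by auto
  have eq: "exp_map s D p $ i = h 0 + (s * h 1 + (\<Sum>k\<in>{2..<N + 2}. s ^ k * h k))" for s
    unfolding exp_map_nth exp_series_finite[OF N2] split by (simp add: h_def)
  have "((\<lambda>s. \<Sum>k\<in>{2..<N + 2}. s ^ k * h k) has_field_derivative
      (\<Sum>k\<in>{2..<N + 2}. 0)) (at 0)"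
  proof (rule DERIV_sum)
    fix k assume "k \<in> {2..<N + 2}"
    then show "((\<lambda>s. s ^ k * h k) has_field_derivative 0) (at 0)"
      by (auto intro!: derivative_eq_intros)
  qed
  then have "((\<lambda>s. h 0 + (s * h 1 + (\<Sum>k\<in>{2..<N + 2}. s ^ k * h k))) has_field_derivative h 1) (at 0)"
    by (auto intro!: derivative_eq_intros)
  then show ?thesis
    unfolding eq by (simp add: h_def)
qed

end

section \<open>Actions of the additive group\<close>

lemma Ga_action_iff:
  fixes V :: "(complex ^ 'n::finite) set"
  shows "Ga_action V \<alpha> \<longleftrightarrow>
    (\<forall>s. \<forall>p\<in>V. \<alpha> s p \<in> V) \<and> (\<forall>p\<in>V. \<alpha> 0 p = p) \<and>
    (\<forall>s r. \<forall>p\<in>V. \<alpha> (s + r) p = \<alpha> s (\<alpha> r p)) \<and>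
    (\<exists>k. (\<forall>i. poly_fun2 (\<lambda>s p. k s p $ i)) \<and> (\<forall>s. \<forall>p\<in>V. \<alpha> s p = k s p))"
proof -
  have "(\<exists>F :: ('n option) mpoly ^ 'n. \<forall>s. \<forall>p\<in>V. \<forall>i. \<alpha> s p $ i = peval (F $ i) (opt_point s p)) \<longleftrightarrow>
    (\<exists>k. (\<forall>i. poly_fun2 (\<lambda>s p. k s p $ i)) \<and> (\<forall>s. \<forall>p\<in>V. \<alpha> s p = k s p))" (is "?L \<longleftrightarrow> ?R")
  proof
    assume ?L
    then obtain F where F: "\<And>s p i. p \<in> V \<Longrightarrow> \<alpha> s p $ i = peval (F $ i) (opt_point s p)"
      by blast
    show ?R
      by (rule exI[of _ "\<lambda>s p. \<chi> i. peval (F $ i) (opt_point s p)"])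
        (auto simp: F vec_eq_iff poly_fun2_def intro: poly_fun_peval)
  next
    assume ?R
    then obtain k F where k: "\<And>i s p. k s p $ i = peval (F i) (opt_point s p)"
        "\<forall>s. \<forall>p\<in>V. \<alpha> s p = k s p"
      unfolding poly_fun2_def poly_fun_def by metis
    show ?L
      by (rule exI[of _ "\<chi> i. F i"]) (auto simp: k)
  qed
  then show ?thesis
    unfolding Ga_action_def opt_point_def by simp
qed

lemma Ga_actionD:
  assumes "Ga_action V \<alpha>" "p \<in> V"
  shows "\<alpha> s p \<in> V" "\<alpha> 0 p = p" "\<alpha> (s + r) p = \<alpha> s (\<alpha> r p)"
  using assms by (auto simp: Ga_action_iff)

lemma Ga_action_regular:
  assumes "Ga_action V \<alpha>"
  obtains k where "\<And>i. poly_fun2 (\<lambda>s p. k s p $ i)" "\<And>s p. p \<in> V \<Longrightarrow> \<alpha> s p = k s p"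
  using assms unfolding Ga_action_iff by metis

lemma (in lnd) Ga_action_exp_map:
  assumes "D f = 0"
  shows "Ga_action (zero_set f) (\<lambda>s. exp_map s D)"
  unfolding Ga_action_iff zero_set_def
  by (intro conjI exI[of _ "\<lambda>s. exp_map s D"])
    (auto simp: exp_map_0 exp_map_add peval_exp_map_kernel[OF assms] poly_fun2_exp_map)

text \<open>
  The factor \<open>h\<close> is constant on orbits, so the times along one orbit still add up.
\<close>

lemma Ga_action_replica:
  assumes \<alpha>: "Ga_action V \<alpha>" and h: "poly_fun h" and inv: "\<And>s p. p \<in> V \<Longrightarrow> h (\<alpha> s p) = h p"
  shows "Ga_action V (\<lambda>s p. \<alpha> (s * h p) p)"
proof -
  obtain k where k: "\<And>i. poly_fun2 (\<lambda>s p. k s p $ i)" "\<And>s p. p \<in> V \<Longrightarrow> \<alpha> s p = k s p"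
    using Ga_action_regular[OF \<alpha>] by blast
  have "poly_fun2 (\<lambda>s p. k (s * h p) p $ i)" for i
    by (rule poly_fun2_compose[OF k(1)])
      (intro poly_fun2_mult poly_fun2_param poly_fun2_point h poly_fun_coord)+
  then show ?thesis
    unfolding Ga_action_iff
    using Ga_actionD[OF \<alpha>] inv k(2)
    by (intro conjI exI[of _ "\<lambda>s p. k (s * h p) p"]) (auto simp: distrib_right)
qed

lemma Ga_action_conjugate:
  assumes \<alpha>: "Ga_action V \<alpha>"
    and poly: "\<And>i. poly_fun (\<lambda>p. F p $ i)" "\<And>i. poly_fun (\<lambda>q. H q $ i)"
    and maps: "\<And>p. p \<in> V \<Longrightarrow> F p \<in> W" "\<And>q. q \<in> W \<Longrightarrow> H q \<in> V"
    and inv: "\<And>p. p \<in> V \<Longrightarrow> H (F p) = p" "\<And>q. q \<in> W \<Longrightarrow> F (H q) = q"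
  shows "Ga_action W (\<lambda>s q. F (\<alpha> s (H q)))"
proof -
  obtain k where k: "\<And>i. poly_fun2 (\<lambda>s p. k s p $ i)" "\<And>s p. p \<in> V \<Longrightarrow> \<alpha> s p = k s p"
    using Ga_action_regular[OF \<alpha>] by blast
  have "poly_fun2 (\<lambda>s q. k s (H q) $ i)" for i
    by (rule poly_fun2_compose[OF k(1) poly_fun2_param poly_fun2_point]) (rule poly)
  then have "poly_fun2 (\<lambda>s q. F (k s (H q)) $ i)" for i
    using poly_fun2_compose[OF poly_fun2_point[OF poly(1)] poly_fun2_param, of "\<lambda>s q. k s (H q)"]
    by simp
  then show ?thesis
    unfolding Ga_action_iff
    using Ga_actionD[OF \<alpha>] maps inv k(2)
    by (intro conjI exI[of _ "\<lambda>s q. F (k s (H q))"]) auto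
qed

section \<open>Automorphism groups\<close>

lemma regular_on_compose:
  assumes "regular_on W f" "regular_on V g" "\<And>p. p \<in> V \<Longrightarrow> g p \<in> W"
  shows "regular_on V (\<lambda>p. f (g p))"
proof -
  obtain f' g' where f: "\<And>i. poly_fun (\<lambda>p. f' p $ i)" "\<And>p. p \<in> W \<Longrightarrow> f p = f' p"
    and g: "\<And>i. poly_fun (\<lambda>p. g' p $ i)" "\<And>p. p \<in> V \<Longrightarrow> g p = g' p"
    using assms(1,2) unfolding regular_on_iff by metis
  show ?thesis
    unfolding regular_on_iff
    by (rule exI[of _ "\<lambda>p. f' (g' p)"])
      (use assms(3) in \<open>auto simp: f(2) g(2)[symmetric] intro: poly_fun_compose[OF f(1) g(1)]\<close>)
qed

lemma regular_on_cong: "(\<And>p. p \<in> V \<Longrightarrow> f p = g p) \<Longrightarrow> regular_on V f \<longleftrightarrow> regular_on V g"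
  by (auto simp: regular_on_iff)

lemma regular_on_id: "regular_on V (\<lambda>p. p)"
  unfolding regular_on_iff by (auto intro: poly_fun_coord)

lemma aut_groupI:
  assumes "f \<in> extensional V" "\<And>p. p \<in> V \<Longrightarrow> f p \<in> V" "\<And>p. p \<in> V \<Longrightarrow> g p \<in> V"
    and inv: "\<And>p. p \<in> V \<Longrightarrow> g (f p) = p" "\<And>p. p \<in> V \<Longrightarrow> f (g p) = p"
    and reg: "regular_on V f" "regular_on V g"
  shows "f \<in> carrier (aut_group V)"
proof -
  have bij: "bij_betw f V V"
    by (rule bij_betw_byWitness[of _ g]) (use assms in auto)
  have "inv_into V f p = g p" if "p \<in> V" for p
    by (rule inv_into_f_eq) (use that assms bij in \<open>auto simp: bij_betw_def\<close>)
  then show ?thesis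
    using assms bij regular_on_cong[of V "inv_into V f" g] by (simp add: aut_group_def Bij_def)
qed

lemma aut_groupD:
  assumes "f \<in> carrier (aut_group V)"
  shows "f \<in> Bij V" "f \<in> extensional V" "p \<in> V \<Longrightarrow> f p \<in> V" "p \<in> V \<Longrightarrow> inv_into V f p \<in> V"
    "p \<in> V \<Longrightarrow> inv_into V f (f p) = p" "p \<in> V \<Longrightarrow> f (inv_into V f p) = p"
    "regular_on V f" "regular_on V (inv_into V f)"
  using assms
  by (auto simp: aut_group_def Bij_def bij_betw_def intro: inv_into_into f_inv_into_f)

lemma aut_group_mult:
  "f \<in> carrier (aut_group V) \<Longrightarrow> g \<in> carrier (aut_group V) \<Longrightarrow> f \<otimes>\<^bsub>aut_group V\<^esub> g = compose V f g"
  by (simp add: aut_group_def BijGroup_def)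

lemma aut_group_one: "\<one>\<^bsub>aut_group V\<^esub> = (\<lambda>p\<in>V. p)"
  by (simp add: aut_group_def BijGroup_def)

lemma compose_in_aut_group:
  assumes f: "f \<in> carrier (aut_group V)" and g: "g \<in> carrier (aut_group V)"
  shows "compose V f g \<in> carrier (aut_group V)"
proof (rule aut_groupI[where g = "\<lambda>p. inv_into V g (inv_into V f p)"])
  show "regular_on V (compose V f g)"
    using regular_on_compose[OF aut_groupD(7)[OF f] aut_groupD(7)[OF g] aut_groupD(3)[OF g]]
    by (subst regular_on_cong) (auto simp: compose_eq)
  show "regular_on V (\<lambda>p. inv_into V g (inv_into V f p))"
    by (rule regular_on_compose[OF aut_groupD(8)[OF g] aut_groupD(8)[OF f] aut_groupD(4)[OF f]])
qed (use aut_groupD[OF f] aut_groupD[OF g] in \<open>auto simp: compose_eq compose_def\<close>)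

lemma inverse_in_aut_group:
  assumes f: "f \<in> carrier (aut_group V)"
  shows "restrict (inv_into V f) V \<in> carrier (aut_group V)"
proof (rule aut_groupI[where g = f])
  show "regular_on V (restrict (inv_into V f) V)"
    using aut_groupD(8)[OF f] by (subst regular_on_cong) auto
qed (use aut_groupD[OF f] in auto)

lemma group_aut_group: "group (aut_group V)"
proof -
  interpret B: group "BijGroup V" by (rule group_BijGroup)
  have car: "carrier (aut_group V) \<subseteq> carrier (BijGroup V)"
    by (auto simp: aut_group_def BijGroup_def)
  have "subgroup (carrier (aut_group V)) (BijGroup V)"
  proof
    show "\<one>\<^bsub>BijGroup V\<^esub> \<in> carrier (aut_group V)"
      unfolding BijGroup_def
      by (auto intro!: aut_groupI[where g = "\<lambda>p. p"] regular_on_id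
          simp: regular_on_cong[of V "restrict (\<lambda>p. p) V" "\<lambda>p. p"])
  next
    fix f assume f: "f \<in> carrier (aut_group V)"
    then show "inv\<^bsub>BijGroup V\<^esub> f \<in> carrier (aut_group V)"
      using inv_BijGroup[of f V] inverse_in_aut_group[OF f] by (simp add: aut_groupD(1))
  next
    fix f g assume "f \<in> carrier (aut_group V)" "g \<in> carrier (aut_group V)"
    then show "f \<otimes>\<^bsub>BijGroup V\<^esub> g \<in> carrier (aut_group V)"
      using compose_in_aut_group[of f V g] by (simp add: BijGroup_def aut_groupD(1))
  qed (rule car)
  from subgroup.subgroup_is_group[OF this group_BijGroup] show ?thesis
    by (simp add: aut_group_def)
qed

lemma aut_group_inv:
  assumes f: "f \<in> carrier (aut_group V)"
  shows "inv\<^bsub>aut_group V\<^esub> f = restrict (inv_into V f) V"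
proof (rule group.inv_equality[OF group_aut_group])
  show "restrict (inv_into V f) V \<otimes>\<^bsub>aut_group V\<^esub> f = \<one>\<^bsub>aut_group V\<^esub>"
    by (rule ext) (use aut_groupD[OF f] in
        \<open>auto simp: aut_group_mult[OF inverse_in_aut_group[OF f] f] aut_group_one compose_def\<close>)
qed (use f inverse_in_aut_group in auto)

lemma Ga_action_regular_on: "Ga_action V \<alpha> \<Longrightarrow> regular_on V (\<alpha> s)"
proof -
  assume "Ga_action V \<alpha>"
  then obtain k where k: "\<And>i. poly_fun2 (\<lambda>s p. k s p $ i)" "\<And>s p. p \<in> V \<Longrightarrow> \<alpha> s p = k s p"
    using Ga_action_regular by blast
  have "poly_fun (\<lambda>p. k s p $ i)" for i
    by (rule poly_fun2_subst[OF k(1) poly_fun_const poly_fun_coord])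
  then show ?thesis
    unfolding regular_on_iff using k(2) by blast
qed

lemma Ga_action_inverse: "Ga_action V \<alpha> \<Longrightarrow> p \<in> V \<Longrightarrow> \<alpha> (- s) (\<alpha> s p) = p"
  using Ga_actionD(2,3)[of V \<alpha> p] by (metis add.left_inverse)

lemma Ga_action_aut:
  assumes "Ga_action V \<alpha>"
  shows "restrict (\<alpha> s) V \<in> carrier (aut_group V)"
proof (rule aut_groupI[where g = "\<alpha> (- s)"])
  show "regular_on V (restrict (\<alpha> s) V)"
    using Ga_action_regular_on[OF assms] by (subst regular_on_cong) auto
qed (use Ga_actionD[OF assms] Ga_action_inverse[OF assms] Ga_action_inverse[OF assms, of _ "- s"]
    Ga_action_regular_on[OF assms] in auto)

lemma subgroup_SAut: "subgroup (SAut V) (aut_group V)"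
  unfolding SAut_def
  by (rule group.generate_is_subgroup[OF group_aut_group]) (auto intro: Ga_action_aut)

lemma zero_set_0: "zero_set 0 = UNIV"
  by (simp add: zero_set_def peval_0)

text \<open>
  For \<open>V = UNIV\<close> the extensional representatives of automorphisms are the maps themselves.
\<close>

lemma restrict_UNIV: "restrict f UNIV = f"
  by (simp add: restrict_def)

lemma (in lnd) exp_map_aut: "exp_map s D \<in> carrier (aut_group UNIV)"
  using Ga_action_aut[OF Ga_action_exp_map[OF zero], of s] by (simp add: zero_set_0 restrict_UNIV)

section \<open>Polynomial paths of automorphisms and general position\<close>

text \<open>
  Families of composites of actions of the additive group, all run with a common parameter. They
  start at the identity, and every composite of elements of such actions is the member at 1 of such
  a family.
\<close>

inductive_set poly_paths ::
    "(complex ^ 'n::finite) set \<Rightarrow> (complex \<Rightarrow> complex ^ 'n \<Rightarrow> complex ^ 'n) set"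
  for V where
    refl: "(\<lambda>s p. p) \<in> poly_paths V"
  | step: "\<gamma> \<in> poly_paths V \<Longrightarrow> Ga_action V \<alpha> \<Longrightarrow> (\<lambda>s p. \<alpha> s (\<gamma> s p)) \<in> poly_paths V"

lemma poly_path_closed: "\<gamma> \<in> poly_paths V \<Longrightarrow> p \<in> V \<Longrightarrow> \<gamma> s p \<in> V"
  by (induction rule: poly_paths.induct) (auto simp: Ga_actionD)

lemma poly_path_0: "\<gamma> \<in> poly_paths V \<Longrightarrow> p \<in> V \<Longrightarrow> \<gamma> 0 p = p"
  by (induction rule: poly_paths.induct) (auto simp: Ga_actionD)

lemma poly_path_inj_on: "\<gamma> \<in> poly_paths V \<Longrightarrow> inj_on (\<gamma> s) V"
proof (induction rule: poly_paths.induct)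
  case (step \<gamma> \<alpha>)
  have "inj_on (\<alpha> s) V"
    by (rule inj_on_inverseI[where g = "\<alpha> (- s)"]) (rule Ga_action_inverse[OF step.hyps(2)])
  then show ?case
    using step poly_path_closed[OF step.hyps(1)] by (auto simp: inj_on_def)
qed simp

lemma poly_path_compose:
  "\<delta> \<in> poly_paths V \<Longrightarrow> \<gamma> \<in> poly_paths V \<Longrightarrow> (\<lambda>s p. \<delta> s (\<gamma> s p)) \<in> poly_paths V"
  by (induction rule: poly_paths.induct) (auto intro: poly_paths.step)

lemma Ga_action_scale: "Ga_action V \<alpha> \<Longrightarrow> Ga_action V (\<lambda>s. \<alpha> (s * c))"
  using Ga_action_replica[of V \<alpha> "\<lambda>_. c"] by (simp add: poly_fun_const)

lemma poly_path_scale: "\<gamma> \<in> poly_paths V \<Longrightarrow> (\<lambda>s. \<gamma> (s * c)) \<in> poly_paths V"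
  by (induction rule: poly_paths.induct)
    (auto intro: poly_paths.refl poly_paths.step[OF _ Ga_action_scale])

lemma poly_path_Ga: "Ga_action V \<alpha> \<Longrightarrow> (\<lambda>s. \<alpha> (s * c)) \<in> poly_paths V"
  using poly_paths.step[OF poly_paths.refl Ga_action_scale] .

lemma poly_path_curve:
  assumes "\<gamma> \<in> poly_paths V" "p \<in> V"
  shows "\<exists>Q. \<forall>s. \<gamma> s p $ i = poly Q s"
  using assms(1)
proof (induction arbitrary: i rule: poly_paths.induct)
  case refl
  show ?case by (rule exI[of _ "[:p $ i:]"]) simp
next
  case (step \<gamma> \<alpha>)
  obtain k where k: "\<And>i. poly_fun2 (\<lambda>s p. k s p $ i)" "\<And>s p. p \<in> V \<Longrightarrow> \<alpha> s p = k s p"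
    using Ga_action_regular[OF step.hyps(2)] by blast
  obtain h where h: "poly_fun h" "\<And>s p. k s p $ i = h (opt_point s p)"
    using k(1)[of i] unfolding poly_fun2_def by blast
  have "\<exists>Q. \<forall>s. opt_point s (\<gamma> s p) $ j = poly Q s" for j
  proof (cases j)
    case None
    then show ?thesis
      by (auto simp: opt_point_nth intro: exI[of _ "[:0, 1:]"])
  next
    case (Some l)
    then show ?thesis
      using step.IH[of l] by (simp add: opt_point_nth)
  qed
  from poly_fun_poly_curve[OF h(1) this] show ?case
    using poly_path_closed[OF step.hyps(1) assms(2)] by (simp add: k(2) h(2))
qed

lemma poly_path_SAut: "\<gamma> \<in> poly_paths V \<Longrightarrow> restrict (\<gamma> s) V \<in> SAut V"
proof (induction rule: poly_paths.induct)
  case refl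
  show ?case
    using subgroup.one_closed[OF subgroup_SAut, of V] by (simp only: aut_group_one)
next
  case (step \<gamma> \<alpha>)
  have \<alpha>: "restrict (\<alpha> s) V \<in> SAut V"
    unfolding SAut_def by (rule generate.incl) (use step.hyps(2) in blast)
  have "restrict (\<lambda>p. \<alpha> s (\<gamma> s p)) V = compose V (restrict (\<alpha> s) V) (restrict (\<gamma> s) V)"
    by (rule ext) (simp add: compose_def poly_path_closed[OF step.hyps(1)])
  also have "\<dots> = restrict (\<alpha> s) V \<otimes>\<^bsub>aut_group V\<^esub> restrict (\<gamma> s) V"
    by (rule aut_group_mult[symmetric]; rule subgroup.mem_carrier[OF subgroup_SAut]) (fact \<alpha> step.IH)+
  finally show ?case
    using subgroup.m_closed[OF subgroup_SAut \<alpha> step.IH] by (simp only:)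
qed

text \<open>
  Tuples of points are moved by one map simultaneously, so that statements about pairs or single points
  apply to the members of a longer tuple by using the same path.
\<close>

definition connects :: "(complex ^ 'n::finite) set \<Rightarrow> (complex ^ 'n) list \<Rightarrow> (complex ^ 'n) list \<Rightarrow> bool"
  where "connects V ps qs \<longleftrightarrow> (\<exists>\<gamma>\<in>poly_paths V. map (\<gamma> 1) ps = qs)"

lemma connects_refl: "connects V ps ps"
  unfolding connects_def using poly_paths.refl[of V] by (intro bexI) auto

lemma connects_trans:
  assumes "connects V ps qs" "connects V qs rs"
  shows "connects V ps rs"
proof -
  obtain \<gamma> \<delta> where "\<gamma> \<in> poly_paths V" "map (\<gamma> 1) ps = qs" "\<delta> \<in> poly_paths V" "map (\<delta> 1) qs = rs"
    using assms by (auto simp: connects_def)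
  then show ?thesis
    unfolding connects_def by (intro bexI[OF _ poly_path_compose[of \<delta> V \<gamma>]]) auto
qed

lemma connects_poly_path: "\<gamma> \<in> poly_paths V \<Longrightarrow> connects V ps (map (\<gamma> s) ps)"
  unfolding connects_def by (rule bexI[OF _ poly_path_scale[of \<gamma> V s]]) auto

lemma connects_Ga: "Ga_action V \<alpha> \<Longrightarrow> connects V ps (map (\<alpha> s) ps)"
  unfolding connects_def by (rule bexI[OF _ poly_path_Ga[of V \<alpha> s]]) auto

lemma connectsD:
  assumes "connects V ps qs" "set ps \<subseteq> V"
  shows "set qs \<subseteq> V" "length qs = length ps" "distinct ps \<Longrightarrow> distinct qs"
proof -
  obtain \<gamma> where g: "\<gamma> \<in> poly_paths V" "map (\<gamma> 1) ps = qs"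
    using assms(1) by (auto simp: connects_def)
  show "set qs \<subseteq> V" "length qs = length ps"
    using poly_path_closed[OF g(1)] assms(2) g(2)[symmetric] by auto
  show "distinct qs" if "distinct ps"
    using that inj_on_subset[OF poly_path_inj_on[OF g(1)] assms(2)] g(2)
    by (auto simp: distinct_map)
qed

lemma poly_common_nonroot:
  fixes Q :: "'i \<Rightarrow> complex poly"
  assumes "finite I" "\<And>i. i \<in> I \<Longrightarrow> Q i \<noteq> 0"
  shows "\<exists>s. \<forall>i\<in>I. poly (Q i) s \<noteq> 0"
proof -
  have "finite (\<Union>i\<in>I. {s. poly (Q i) s = 0})"
    using assms by (auto intro: poly_roots_finite)
  then obtain s where "s \<notin> (\<Union>i\<in>I. {s. poly (Q i) s = 0})"
    using infinite_UNIV_char_0 ex_new_if_finite by blast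
  then show ?thesis by blast
qed

text \<open>
  Suppose that all earlier conditions hold at \<open>qs\<close> and that a path from \<open>qs\<close> ends at a tuple where the
  new condition holds. Along the path each condition is a polynomial in the parameter; those of the
  earlier conditions are nonzero at \<open>0\<close>, that of the new one at \<open>1\<close>. So all of them are nonzero at all
  but finitely many parameters.
\<close>

lemma general_position:
  fixes \<Phi> :: "'i \<Rightarrow> (complex ^ 'n::finite) list \<Rightarrow> complex"
  assumes fin: "finite I" and ps: "set ps \<subseteq> V"
    and poly: "\<And>i \<gamma> qs. i \<in> I \<Longrightarrow> \<gamma> \<in> poly_paths V \<Longrightarrow> set qs \<subseteq> V \<Longrightarrow> length qs = length ps \<Longrightarrow>
      \<exists>Q. \<forall>s. \<Phi> i (map (\<gamma> s) qs) = poly Q s"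
    and reach: "\<And>i qs. i \<in> I \<Longrightarrow> connects V ps qs \<Longrightarrow> \<exists>rs. connects V qs rs \<and> \<Phi> i rs \<noteq> 0"
  shows "\<exists>qs. connects V ps qs \<and> (\<forall>i\<in>I. \<Phi> i qs \<noteq> 0)"
  using fin poly reach
proof (induction I rule: finite_induct)
  case empty
  show ?case using connects_refl by blast
next
  case (insert i I)
  obtain qs where qs: "connects V ps qs" "\<forall>j\<in>I. \<Phi> j qs \<noteq> 0"
    using insert.IH insert.prems by blast
  obtain rs where rs: "connects V qs rs" "\<Phi> i rs \<noteq> 0"
    using insert.prems(2)[of i] qs(1) by blast
  then obtain \<gamma> where \<gamma>: "\<gamma> \<in> poly_paths V" "map (\<gamma> 1) qs = rs"
    by (auto simp: connects_def)
  have qsV: "set qs \<subseteq> V" "length qs = length ps"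
    using connectsD[OF qs(1) ps] by auto
  have "\<forall>j\<in>insert i I. \<exists>Q. \<forall>s. \<Phi> j (map (\<gamma> s) qs) = poly Q s"
    using insert.prems(1) \<gamma>(1) qsV by blast
  then obtain Q where Q: "\<And>j s. j \<in> insert i I \<Longrightarrow> \<Phi> j (map (\<gamma> s) qs) = poly (Q j) s"
    by metis
  have "map (\<gamma> 0) qs = qs"
    using qsV(1) poly_path_0[OF \<gamma>(1)] by (intro map_idI) auto
  then have "poly (Q j) 0 \<noteq> 0" if "j \<in> I" for j
    using Q[of j 0] qs(2) that by auto
  moreover have "poly (Q i) 1 \<noteq> 0"
    using Q[of i 1] rs(2) \<gamma>(2) by auto
  ultimately have "Q j \<noteq> 0" if "j \<in> insert i I" for j
    using that by (metis insertE poly_0)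
  then obtain s where s: "\<forall>j\<in>insert i I. poly (Q j) s \<noteq> 0"
    using poly_common_nonroot[of "insert i I" Q] insert.hyps(1) by blast
  have "connects V ps (map (\<gamma> s) qs)"
    by (rule connects_trans[OF qs(1) connects_poly_path[OF \<gamma>(1)]])
  then show ?case
    using Q s by auto
qed

text \<open>
  Since the group contains inverses, it suffices to bring every tuple to a normal form that depends
  only on its length.
\<close>

lemma infinitely_transitiveI:
  assumes norm: "\<And>ps. distinct ps \<Longrightarrow> set ps \<subseteq> V \<Longrightarrow> connects V ps (c (length ps))"
  shows "infinitely_transitive (SAut V) V"
  unfolding infinitely_transitive_def k_transitive_def
proof (intro allI impI, elim conjE)
  fix k ps qs
  assume ps: "length ps = k" "distinct ps" "set ps \<subseteq> V"
    and qs: "length qs = k" "distinct qs" "set qs \<subseteq> V"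
  have ex: "\<exists>g\<in>SAut V. map g rs = c k" if rs: "length rs = k" "distinct rs" "set rs \<subseteq> V" for rs
  proof -
    obtain \<gamma> where \<gamma>: "\<gamma> \<in> poly_paths V" "map (\<gamma> 1) rs = c k"
      using norm[OF rs(2,3)] rs(1) by (auto simp: connects_def)
    have "map (restrict (\<gamma> 1) V) rs = c k"
      unfolding \<gamma>(2)[symmetric] using rs(3) by (intro map_cong) auto
    then show ?thesis
      using poly_path_SAut[OF \<gamma>(1)] by blast
  qed
  obtain g h where g: "g \<in> SAut V" "map g ps = c k" and h: "h \<in> SAut V" "map h qs = c k"
    using ex[OF ps] ex[OF qs] by blast
  note car = subgroup.mem_carrier[OF subgroup_SAut]
  let ?h' = "restrict (inv_into V h) V"
  have h': "?h' \<in> SAut V"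
    using subgroup.m_inv_closed[OF subgroup_SAut h(1)] aut_group_inv[OF car[OF h(1)]] by simp
  have "compose V ?h' g \<in> SAut V"
    using subgroup.m_closed[OF subgroup_SAut h' g(1)] aut_group_mult[OF car[OF h'] car[OF g(1)]]
    by simp
  moreover have "map (compose V ?h' g) ps = qs"
  proof -
    have "compose V ?h' g p = inv_into V h (g p)" if "p \<in> set ps" for p
      using that ps(3) aut_groupD(3)[OF car[OF g(1)], of p] by (auto simp: compose_def)
    then have "map (compose V ?h' g) ps = map (inv_into V h) (map g ps)"
      by simp
    also have "\<dots> = map (inv_into V h) (map h qs)"
      using g(2) h(2) by simp
    also have "\<dots> = qs"
      unfolding map_map
      by (rule map_idI) (use aut_groupD(5)[OF car[OF h(1)]] qs(3) in auto)
    finally show ?thesis .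
  qed
  ultimately show "\<exists>g\<in>SAut V. map g ps = qs"
    by blast
qed

lemma polynomial_interpolation:
  assumes "finite A"
  shows "\<exists>Q :: complex poly. \<forall>a\<in>A. poly Q a = f a"
  using assms
proof (induction A rule: finite_induct)
  case (insert a A)
  then obtain Q :: "complex poly" where Q: "\<forall>b\<in>A. poly Q b = f b"
    by blast
  let ?R = "\<Prod>b\<in>A. [:- b, 1:]"
  have "poly ?R a \<noteq> 0"
    using insert.hyps by (auto simp: poly_prod)
  moreover have "poly ?R b = 0" if "b \<in> A" for b
    using insert.hyps that by (auto simp: poly_prod)
  ultimately have "\<forall>b\<in>insert a A. poly (Q + smult ((f a - poly Q a) / poly ?R a) ?R) b = f b"
    using Q insert.hyps by auto
  then show ?case by blast
qed simp

text \<open>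
  With interpolation a replica moves finitely many points by independent times, if an invariant of
  the action separates them.
\<close>

lemma connects_independent_times:
  assumes \<alpha>: "Ga_action V \<alpha>" and h: "poly_fun h" and inv: "\<And>s p. p \<in> V \<Longrightarrow> h (\<alpha> s p) = h p"
    and inj: "inj_on h (set ps)"
  shows "connects V ps (map (\<lambda>p. \<alpha> (f p) p) ps)"
proof -
  obtain Q where Q: "\<forall>a\<in>h ` set ps. poly Q a = f (the_inv_into (set ps) h a)"
    using polynomial_interpolation[of "h ` set ps" "\<lambda>a. f (the_inv_into (set ps) h a)"] by auto
  have "Ga_action V (\<lambda>s p. \<alpha> (s * poly Q (h p)) p)"
    by (rule Ga_action_replica[OF \<alpha> poly_fun_poly[OF h]]) (simp add: inv)
  from connects_Ga[OF this, of ps 1] show ?thesis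
    using Q by (simp add: the_inv_into_f_f[OF inj] cong: map_cong)
qed

lemma connects_conjugate:
  assumes poly: "\<And>i. poly_fun (\<lambda>p. F p $ i)" "\<And>i. poly_fun (\<lambda>q. H q $ i)"
    and maps: "\<And>p. p \<in> V \<Longrightarrow> F p \<in> W" "\<And>q. q \<in> W \<Longrightarrow> H q \<in> V"
    and inv: "\<And>p. H (F p) = p" "\<And>q. F (H q) = q"
    and connects: "connects V ps qs"
  shows "connects W (map F ps) (map F qs)"
proof -
  have "(\<lambda>s q. F (\<gamma> s (H q))) \<in> poly_paths W" if "\<gamma> \<in> poly_paths V" for \<gamma>
    using that
  proof (induction rule: poly_paths.induct)
    case refl
    show ?case by (simp add: inv poly_paths.refl)
  next
    case (step \<gamma> \<alpha>)
    from poly_paths.step[OF step.IH Ga_action_conjugate[OF step.hyps(2) poly maps inv]]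
    show ?case by (simp add: inv)
  qed
  moreover obtain \<gamma> where "\<gamma> \<in> poly_paths V" "map (\<gamma> 1) ps = qs"
    using connects by (auto simp: connects_def)
  ultimately show ?thesis
    unfolding connects_def by (intro bexI[of _ "\<lambda>s q. F (\<gamma> s (H q))"]) (auto simp: inv)
qed

section \<open>Groups generated by exponentials\<close>

lemma exp_map_in_exp_group: "D \<in> \<D> \<Longrightarrow> exp_map s D \<in> exp_group \<D>"
  unfolding exp_group_def by (rule generate.incl) blast

lemma subgroup_exp_group:
  assumes "\<And>D. D \<in> \<D> \<Longrightarrow> lnd D"
  shows "subgroup (exp_group \<D>) (aut_group UNIV)"
  unfolding exp_group_def
  by (rule group.generate_is_subgroup[OF group_aut_group]) (auto intro: lnd.exp_map_aut assms)

text \<open>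
  This makes transitivity of the generated group available for general position arguments.
\<close>

lemma exp_group_poly_path:
  assumes D: "\<And>D. D \<in> \<D> \<Longrightarrow> lnd D \<and> D f = 0" and "g \<in> exp_group \<D>"
  shows "\<exists>\<gamma>\<in>poly_paths (zero_set f). \<gamma> 1 = g"
  using assms(2) unfolding exp_group_def
proof (induction rule: generate.induct)
  case one
  show ?case
    by (rule bexI[OF _ poly_paths.refl]) (auto simp: aut_group_one)
next
  case (incl h)
  then obtain s D where h: "h = exp_map s D" "D \<in> \<D>" by blast
  then show ?case
    using poly_path_Ga[OF lnd.Ga_action_exp_map, of D f s] D[OF h(2)] by (intro bexI) auto
next
  case (inv h)
  then obtain s D where h: "h = exp_map s D" "D \<in> \<D>" by blast
  interpret lnd D using D[OF h(2)] by simp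
  have "exp_map (- s) D \<otimes>\<^bsub>aut_group UNIV\<^esub> exp_map s D = \<one>\<^bsub>aut_group UNIV\<^esub>"
    by (rule ext)
      (simp add: aut_group_mult exp_map_aut aut_group_one compose_def flip: exp_map_add, simp add: exp_map_0)
  then have "inv\<^bsub>aut_group UNIV\<^esub> h = exp_map (- s) D"
    by (simp add: h(1) group.inv_equality[OF group_aut_group] exp_map_aut)
  then show ?case
    using poly_path_Ga[OF Ga_action_exp_map, of f "- s"] D[OF h(2)] by (intro bexI) auto
next
  case (eng g h)
  have car: "generate (aut_group UNIV) {exp_map s D |s D. D \<in> \<D>} \<subseteq> carrier (aut_group UNIV)"
    by (rule group.generate_incl[OF group_aut_group]) (use D in \<open>auto intro: lnd.exp_map_aut\<close>)
  have "g \<otimes>\<^bsub>aut_group UNIV\<^esub> h = (\<lambda>p. g (h p))"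
    using car eng.hyps by (subst aut_group_mult) (auto simp: compose_def)
  then show ?case
    using eng.IH poly_path_compose by fastforce
qed

lemma subgroup_aut_UNIV_mult:
  assumes "subgroup G (aut_group UNIV)" "g \<in> G" "h \<in> G"
  shows "g \<otimes>\<^bsub>aut_group UNIV\<^esub> h = (\<lambda>p. g (h p))" "(\<lambda>p. g (h p)) \<in> G"
proof -
  show eq: "g \<otimes>\<^bsub>aut_group UNIV\<^esub> h = (\<lambda>p. g (h p))"
    using subgroup.mem_carrier[OF assms(1)] assms(2,3)
    by (subst aut_group_mult) (auto simp: compose_def)
  show "(\<lambda>p. g (h p)) \<in> G"
    using subgroup.m_closed[OF assms] eq by simp
qed

lemma subgroup_aut_UNIV_inverse:
  assumes "subgroup G (aut_group UNIV)" "g \<in> G"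
  obtains h where "h \<in> G" "\<And>p. h (g p) = p" "\<And>p. g (h p) = p"
proof
  have g: "g \<in> carrier (aut_group UNIV)"
    by (rule subgroup.mem_carrier[OF assms])
  show "inv_into UNIV g \<in> G"
    using subgroup.m_inv_closed[OF assms] aut_group_inv[OF g] by (simp add: restrict_UNIV)
qed (use aut_groupD[OF subgroup.mem_carrier[OF assms]] in auto)

lemma exp_group_image:
  assumes D: "\<And>D. D \<in> \<D> \<Longrightarrow> lnd D \<and> D f = 0" and g: "g \<in> exp_group \<D>"
  shows "g ` zero_set f = zero_set f"
proof -
  have sub: "h p \<in> zero_set f" if h: "h \<in> exp_group \<D>" "p \<in> zero_set f" for h p
  proof -
    obtain \<gamma> where "\<gamma> \<in> poly_paths (zero_set f)" "\<gamma> 1 = h"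
      using exp_group_poly_path[OF D h(1)] by blast
    then show ?thesis
      using poly_path_closed h(2) by blast
  qed
  have G: "subgroup (exp_group \<D>) (aut_group UNIV)"
    by (rule subgroup_exp_group) (use D in blast)
  obtain h where "h \<in> exp_group \<D>" "\<And>p. g (h p) = p"
    using subgroup_aut_UNIV_inverse[OF G g] by metis
  then have "zero_set f \<subseteq> g ` zero_set f"
    using sub by (metis image_eqI subsetI)
  then show ?thesis
    using sub[OF g] by auto
qed

lemma transitive_actionI:
  assumes G: "subgroup G (aut_group UNIV)" and pres: "\<And>g. g \<in> G \<Longrightarrow> g ` V = V"
    and reach: "\<And>p. p \<in> V \<Longrightarrow> \<exists>g\<in>G. g p = q"
  shows "transitive_action ((aut_group UNIV)\<lparr>carrier := G\<rparr>) V (\<lambda>g. restrict g V)"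
proof -
  have bij: "restrict g V \<in> Bij V" if g: "g \<in> G" for g
  proof -
    have "inj_on g V"
      using subgroup_aut_UNIV_inverse[OF G g] by (metis inj_on_inverseI)
    then show ?thesis
      using pres[OF g] by (simp add: Bij_def bij_betw_def inj_on_restrict_eq)
  qed
  have hom: "(\<lambda>g. restrict g V) \<in> hom ((aut_group UNIV)\<lparr>carrier := G\<rparr>) (BijGroup V)"
  proof (rule homI)
    fix g h assume "g \<in> carrier ((aut_group UNIV)\<lparr>carrier := G\<rparr>)"
      "h \<in> carrier ((aut_group UNIV)\<lparr>carrier := G\<rparr>)"
    then have gh: "g \<in> G" "h \<in> G" by auto
    have "h p \<in> V" if "p \<in> V" for p
      using pres[OF gh(2)] that by blast
    then have "restrict (\<lambda>p. g (h p)) V = compose V (restrict g V) (restrict h V)"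
      by (auto simp: compose_def restrict_def)
    then show "restrict (g \<otimes>\<^bsub>(aut_group UNIV)\<lparr>carrier := G\<rparr>\<^esub> h) V =
        restrict g V \<otimes>\<^bsub>BijGroup V\<^esub> restrict h V"
      using bij gh subgroup_aut_UNIV_mult(1)[OF G gh] by (simp add: BijGroup_def)
  qed (use bij in \<open>auto simp: BijGroup_def\<close>)
  show ?thesis
  proof (intro transitive_action.intro group_action.intro group_hom.intro group_hom_axioms.intro
      transitive_action_axioms.intro)
    show "group ((aut_group UNIV)\<lparr>carrier := G\<rparr>)"
      by (rule subgroup.subgroup_is_group[OF G group_aut_group])
    show "\<exists>g\<in>carrier ((aut_group UNIV)\<lparr>carrier := G\<rparr>). restrict g V x = y"
      if xy: "x \<in> V" "y \<in> V" for x y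
    proof -
      obtain g h where g: "g \<in> G" "g x = q" and h: "h \<in> G" "h y = q"
        using reach xy by metis
      obtain h' where h': "h' \<in> G" "\<And>p. h' (h p) = p"
        using subgroup_aut_UNIV_inverse[OF G h(1)] by metis
      show ?thesis
        by (rule bexI[of _ "\<lambda>p. h' (g p)"])
          (use subgroup_aut_UNIV_mult(2)[OF G h'(1) g(1)] g h h'(2)[of y] xy in auto)
    qed
  qed (use hom group_BijGroup in auto)
qed

section \<open>Orbit tangents\<close>

lemma subspace_tangent_space: "vec.subspace (tangent_space V q)"
proof (rule vec.subspaceI)
  fix c v assume "v \<in> tangent_space V q"
  moreover have "(\<Sum>i\<in>UNIV. peval (pdiff i f) q * (c *s v) $ i) =
      c * (\<Sum>i\<in>UNIV. peval (pdiff i f) q * v $ i)" for f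
    by (simp add: sum_distrib_left mult_ac)
  ultimately show "c *s v \<in> tangent_space V q"
    by (simp add: tangent_space_def)
qed (auto simp: tangent_space_def distrib_left sum.distrib)

lemma orbit_tangents_subset_tangent_space:
  assumes "q \<in> V"
  shows "orbit_tangents V q \<subseteq> tangent_space V q"
proof
  fix v assume "v \<in> orbit_tangents V q"
  then obtain \<alpha> where \<alpha>: "Ga_action V \<alpha>"
    and v: "\<And>i. ((\<lambda>s. \<alpha> s q $ i) has_field_derivative v $ i) (at 0)"
    by (auto simp: orbit_tangents_def)
  have "(\<Sum>i\<in>UNIV. peval (pdiff i f) q * v $ i) = 0" if f: "\<forall>p\<in>V. peval f p = 0" for f
  proof -
    have "((\<lambda>s. peval f (\<alpha> s q)) has_field_derivative
        (\<Sum>i\<in>UNIV. peval (pdiff i f) q * v $ i)) (at 0)"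
      using peval_has_field_derivative_curve[OF v, of f] Ga_actionD(2)[OF \<alpha> assms] by simp
    moreover have "(\<lambda>s. peval f (\<alpha> s q)) = (\<lambda>s. 0)"
      using f Ga_actionD(1)[OF \<alpha> assms] by auto
    ultimately show ?thesis
      by (metis DERIV_const DERIV_unique)
  qed
  then show "v \<in> tangent_space V q"
    by (simp add: tangent_space_def)
qed

text \<open>
  Codimension at most one, expressed by an additional spanning vector instead of dimensions: in this
  form it is visibly preserved by surjective linear maps.
\<close>

definition tangents_span_hyperplane :: "(complex ^ 'n::finite) set \<Rightarrow> complex ^ 'n \<Rightarrow> bool" where
  "tangents_span_hyperplane V q \<longleftrightarrow> (\<exists>e. vec.span (insert e (orbit_tangents V q)) = UNIV)"

text \<open>
  A subspace between a hyperplane and the whole space is one of the two.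
\<close>

lemma flexibleI:
  assumes span: "\<And>q. q \<in> V \<Longrightarrow> tangents_span_hyperplane V q"
    and proper: "\<And>q. q \<in> V \<Longrightarrow> tangent_space V q \<noteq> UNIV"
  shows "flexible V"
  unfolding flexible_def
proof (intro ballI equalityI)
  fix q assume q: "q \<in> V"
  let ?S = "orbit_tangents V q" and ?T = "tangent_space V q"
  show ST: "vec.span ?S \<subseteq> ?T"
    by (rule vec.span_minimal[OF orbit_tangents_subset_tangent_space[OF q] subspace_tangent_space])
  obtain e where e: "vec.span (insert e ?S) = UNIV"
    using span[OF q] by (auto simp: tangents_span_hyperplane_def)
  have "e \<notin> ?T"
  proof
    assume "e \<in> ?T"
    then have "vec.span (insert e ?S) \<subseteq> ?T"
      using orbit_tangents_subset_tangent_space[OF q]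
      by (intro vec.span_minimal[OF _ subspace_tangent_space]) auto
    then show False using e proper[OF q] by auto
  qed
  show "?T \<subseteq> vec.span ?S"
  proof
    fix v assume v: "v \<in> ?T"
    obtain k where k: "v - k *s e \<in> vec.span ?S"
      using e vec.span_breakdown_eq[of v e ?S] by auto
    have "v - (v - k *s e) \<in> ?T"
      using vec.subspace_diff[OF subspace_tangent_space v] k ST by blast
    then have ke: "k *s e \<in> ?T" by simp
    have "k = 0"
    proof (rule ccontr)
      assume "k \<noteq> 0"
      then have "inverse k *s (k *s e) = e"
        by simp
      then show False
        using vec.subspace_scale[OF subspace_tangent_space ke, of "inverse k"] \<open>e \<notin> ?T\<close> by simp
    qed
    then show "v \<in> vec.span ?S"
      using k by simp
  qed
qed

text \<open>
  Conjugation by a polynomial automorphism carries actions to actions, hence its Jacobian matrix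
  carries orbit tangents to orbit tangents; the Jacobian matrix is invertible by the chain rule.
\<close>

lemma tangents_span_hyperplane_transport:
  assumes poly: "\<And>i. poly_fun (\<lambda>p. F p $ i)" "\<And>i. poly_fun (\<lambda>q. H q $ i)"
    and maps: "\<And>p. p \<in> V \<Longrightarrow> F p \<in> W" "\<And>q. q \<in> W \<Longrightarrow> H q \<in> V"
    and inv: "\<And>p. H (F p) = p" "\<And>q. F (H q) = q"
    and q: "q \<in> V" and span: "tangents_span_hyperplane V q"
  shows "tangents_span_hyperplane W (F q)"
proof -
  obtain P where P: "\<And>p i. F p $ i = peval (P i) p"
    using poly(1) unfolding poly_fun_def by metis
  obtain R where R: "\<And>p i. H p $ i = peval (R i) p"
    using poly(2) unfolding poly_fun_def by metis
  define A where "A = (\<chi> i j. peval (pdiff j (P i)) q)"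
  have chain: "((\<lambda>s. F (k s) $ i) has_field_derivative (A *v v) $ i) (at 0)"
    if "k 0 = q" "\<And>i. ((\<lambda>s. k s $ i) has_field_derivative v $ i) (at 0)" for k v i
    using peval_has_field_derivative_curve[OF that(2), of "P i"]
    by (simp add: P that(1) A_def matrix_vector_mult_def)
  have tangent: "A *v v \<in> orbit_tangents W (F q)" if t: "v \<in> orbit_tangents V q" for v
  proof -
    obtain \<alpha> where \<alpha>: "Ga_action V \<alpha>"
      and v: "\<And>i. ((\<lambda>s. \<alpha> s q $ i) has_field_derivative v $ i) (at 0)"
      using t by (auto simp: orbit_tangents_def)
    have "Ga_action W (\<lambda>s p. F (\<alpha> s (H p)))"
      by (rule Ga_action_conjugate[OF \<alpha> poly maps inv])
    then show ?thesis
      using chain[of "\<lambda>s. \<alpha> s q", OF Ga_actionD(2)[OF \<alpha> q] v] unfolding orbit_tangents_def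
      by (auto intro!: exI[of _ "\<lambda>s p. F (\<alpha> s (H p))"] simp: inv)
  qed
  have surj: "\<exists>v. A *v v = w" for w
  proof -
    have line: "((\<lambda>s. (F q + s *s w) $ i) has_field_derivative w $ i) (at 0)" for i
      by (auto intro!: derivative_eq_intros)
    define v where "v = (\<chi> i. \<Sum>j\<in>UNIV. peval (pdiff j (R i)) (F q) * w $ j)"
    have "((\<lambda>s. H (F q + s *s w) $ i) has_field_derivative v $ i) (at 0)" for i
      using peval_has_field_derivative_curve[OF line, of "R i"] by (simp add: R v_def)
    from chain[OF _ this] have "((\<lambda>s. (F q + s *s w) $ i) has_field_derivative (A *v v) $ i) (at 0)" for i
      by (simp add: inv)
    with line have "(A *v v) $ i = w $ i" for i
      by (metis DERIV_unique)
    then show ?thesis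
      by (auto simp: vec_eq_iff)
  qed
  obtain e where e: "vec.span (insert e (orbit_tangents V q)) = UNIV"
    using span by (auto simp: tangents_span_hyperplane_def)
  have "UNIV = (*v) A ` vec.span (insert e (orbit_tangents V q))"
    unfolding e using surj by (metis surj_def)
  also have "\<dots> = vec.span ((*v) A ` insert e (orbit_tangents V q))"
    by (rule vec.span_image[symmetric])
  also have "\<dots> \<subseteq> vec.span (insert (A *v e) (orbit_tangents W (F q)))"
    by (rule vec.span_mono) (use tangent in auto)
  finally show ?thesis
    unfolding tangents_span_hyperplane_def by blast
qed

section \<open>The four derivations\<close>

lemma exhaust_5: "x = 1 \<or> x = 2 \<or> x = 3 \<or> x = 4 \<or> x = 5" for x :: 5
proof (induct x)
  case (of_int z)
  then have "0 \<le> z" and "z < 5" by simp_all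
  then have "z = 0 \<or> z = 1 \<or> z = 2 \<or> z = 3 \<or> z = 4" by arith
  then show ?case by auto
qed

lemma forall_5: "(\<forall>i::5. Q i) \<longleftrightarrow> Q 1 \<and> Q 2 \<and> Q 3 \<and> Q 4 \<and> Q 5"
  by (metis exhaust_5)

lemmas vec_eq_5 = vec_eq_iff[where ?'b = 5, unfolded forall_5]

lemma tau_Var: "tau vx = 0" "tau vy = 2 * vu" "tau vz = - vx" "tau vt = 0" "tau vu = 1"
  by (simp_all add: tau_def vfield_Var vector_5)

lemma delta_z_Var: "delta_z vx = 0" "delta_z vy = - 2 * (vz + vx * vu)" "delta_z vz = vx ^ 2"
    "delta_z vt = 0" "delta_z vu = 0"
  by (simp_all add: delta_z_def vfield_Var vector_5)

lemma delta_t_Var: "delta_t vx = 0" "delta_t vy = - 3 * vt ^ 2" "delta_t vz = 0"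
    "delta_t vt = vx ^ 2" "delta_t vu = 0"
  by (simp_all add: delta_t_def vfield_Var vector_5)

interpretation tau: C_deriv tau
  unfolding tau_def by (rule C_deriv_vfield)

interpretation delta_z: C_deriv delta_z
  unfolding delta_z_def by (rule C_deriv_vfield)

interpretation delta_t: C_deriv delta_t
  unfolding delta_t_def by (rule C_deriv_vfield)

interpretation E: C_deriv E_der
  unfolding E_der_def Let_def by (rule C_deriv_vfield)

interpretation tau: lnd tau
proof
  have "tau.nilp vx" "tau.nilp vt"
    by (auto intro: tau.nilp_kernel simp: tau_Var)
  moreover have "tau.nilp vu"
    by (rule tau.nilp_D) (simp add: tau_Var tau.nilp_one)
  moreover have "tau.nilp vz" "tau.nilp vy"
    by (rule tau.nilp_D; use calculation in \<open>auto simp: tau_Var intro: tau.nilp_intros\<close>)+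
  ultimately show "locally_nilpotent tau"
    by (metis tau.locally_nilpotentI exhaust_5)
qed

interpretation delta_z: lnd delta_z
proof
  have "delta_z.nilp vx" "delta_z.nilp vt" "delta_z.nilp vu"
    by (auto intro: delta_z.nilp_kernel simp: delta_z_Var)
  moreover have "delta_z.nilp vz"
    by (rule delta_z.nilp_D) (use calculation in \<open>auto simp: delta_z_Var intro: delta_z.nilp_intros\<close>)
  moreover have "delta_z.nilp vy"
    by (rule delta_z.nilp_D)
      (use calculation in \<open>auto simp: delta_z_Var intro!: delta_z.nilp_intros\<close>)
  ultimately show "locally_nilpotent delta_z"
    by (metis delta_z.locally_nilpotentI exhaust_5)
qed

interpretation delta_t: lnd delta_t
proof
  have "delta_t.nilp vx" "delta_t.nilp vz" "delta_t.nilp vu"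
    by (auto intro: delta_t.nilp_kernel simp: delta_t_Var)
  moreover have "delta_t.nilp vt"
    by (rule delta_t.nilp_D) (use calculation in \<open>auto simp: delta_t_Var intro: delta_t.nilp_intros\<close>)
  moreover have "delta_t.nilp vy"
    by (rule delta_t.nilp_D)
      (use calculation in \<open>auto simp: delta_t_Var intro!: delta_t.nilp_intros\<close>)
  ultimately show "locally_nilpotent delta_t"
    by (metis delta_t.locally_nilpotentI exhaust_5)
qed

text \<open>
  The elements \<open>a\<close> and \<open>c\<close>, which together with \<open>y\<close> are the invariants that describe the orbits of
  \<open>E\<close>.
\<close>

abbreviation va :: "5 mpoly" where "va \<equiv> 1 + vx * vy + 2 * vz * vu"
abbreviation vc :: "5 mpoly" where "vc \<equiv> vz * vy - 2 * va * vu"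

text \<open>
  In \<open>a\<close>, \<open>c\<close> and the equation of \<open>Y\<close> every coefficient of a positive power of \<open>u\<close> is even. So \<open>E(u)\<close>
  enters the computations below only through its double, and the fraction disappears.
\<close>

lemma two_E_vu: "2 * E_der vu = - 3 * vy ^ 2 * vt ^ 2"
proof -
  have "2 * Const (3 / 2) = (Const 2 * Const (3 / 2) :: 5 mpoly)"
    by (simp only: numeral_eq_Const)
  also have "\<dots> = Const 3"
    by (simp flip: Const_mult)
  also have "\<dots> = 3"
    by (rule numeral_eq_Const[symmetric])
  finally have "2 * (- Const (3 / 2) * w) = - 3 * w" for w :: "5 mpoly"
    by (simp only: mult_minus_left mult_minus_right mult.assoc[symmetric])
  from this[of "vy ^ 2 * vt ^ 2"] show ?thesis
    by (simp add: E_der_Var(5) mult.assoc)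
qed

lemma E_va: "E_der va = 0"
proof -
  have "E_der va = vy * E_der vx + 2 * vu * E_der vz + vz * (2 * E_der vu)"
    by (simp add: E.rules E_der_Var(2) algebra_simps)
  then show ?thesis
    unfolding two_E_vu E_der_Var(1,3) by (simp add: algebra_simps power2_eq_square)
qed

lemma E_vc: "E_der vc = 0"
proof -
  have "E_der vc = vy * E_der vz - va * (2 * E_der vu) - 2 * vu * E_der va"
    by (simp only: E.diff E.mult E.numeral E_der_Var(2)) (simp add: algebra_simps)
  then show ?thesis
    unfolding two_E_vu E_der_Var(3) E_va by (simp add: algebra_simps power2_eq_square)
qed

lemma E_vt: "E_der vt = va * vc"
  by (rule E_der_Var(4))

interpretation E: lnd E_der
proof
  have ker: "E.nilp vy" "E.nilp va" "E.nilp vc"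
    by (rule E.nilp_kernel, rule E_der_Var E_va E_vc)+
  have t: "E.nilp vt"
    by (rule E.nilp_D) (unfold E_vt, intro E.nilp_mult ker)
  have u: "E.nilp vu"
    by (rule E.nilp_D) (unfold E_der_Var, intro E.nilp_mult E.nilp_uminus E.nilp_Const E.nilp_power ker t)
  have z: "E.nilp vz"
    by (rule E.nilp_D) (unfold E_der_Var,
        intro E.nilp_mult E.nilp_uminus E.nilp_numeral E.nilp_power ker t)
  have x: "E.nilp vx"
    by (rule E.nilp_D) (unfold E_der_Var,
        intro E.nilp_mult E.nilp_add[of "vz * vy"] E.nilp_numeral E.nilp_power ker t u z)
  show "locally_nilpotent E_der"
    using ker(1) t u z x by (metis E.locally_nilpotentI exhaust_5)
qed

lemma tau_P: "tau P_tilde = 0"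
  by (simp add: P_tilde_def tau.rules tau_Var algebra_simps power2_eq_square)

lemma delta_z_P: "delta_z P_tilde = 0"
  by (simp add: P_tilde_def delta_z.rules delta_z_Var algebra_simps power2_eq_square)

lemma delta_t_P: "delta_t P_tilde = 0"
  by (simp add: P_tilde_def delta_t.rules delta_t_Var algebra_simps power2_eq_square)

lemma E_P: "E_der P_tilde = 0"
proof -
  have "E_der P_tilde = (2 * vx * vy + 2 * vz * vu + 1) * E_der vx + 2 * (vx * vu + vz) * E_der vz +
      vx * vz * (2 * E_der vu) + 3 * vt ^ 2 * E_der vt"
    by (simp add: P_tilde_def E.rules E_der_Var(2) algebra_simps)
  then show ?thesis
    unfolding two_E_vu E_der_Var(1,3,4) by (simp add: algebra_simps power2_eq_square)
qed

abbreviation four_derivations :: "(5 mpoly \<Rightarrow> 5 mpoly) set" where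
  "four_derivations \<equiv> {tau, delta_z, delta_t, E_der}"

lemma four_derivations_lnd: "D \<in> four_derivations \<Longrightarrow> lnd D \<and> D P_tilde = 0"
  using tau.lnd_axioms delta_z.lnd_axioms delta_t.lnd_axioms E.lnd_axioms tau_P delta_z_P delta_t_P E_P
  by auto

lemma Ga_action_Y: "D \<in> four_derivations \<Longrightarrow> Ga_action Y_hyp (\<lambda>s. exp_map s D)"
  unfolding Y_hyp_def using four_derivations_lnd lnd.Ga_action_exp_map by blast

lemma exp_map_Y: "D \<in> four_derivations \<Longrightarrow> p \<in> Y_hyp \<Longrightarrow> exp_map s D p \<in> Y_hyp"
  using Ga_actionD(1)[OF Ga_action_Y] .

section \<open>The flows in coordinates\<close>

lemma Y_hyp_iff: "p \<in> Y_hyp \<longleftrightarrow>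
    (p $ 1)\<^sup>2 * p $ 2 + 2 * p $ 1 * p $ 3 * p $ 5 + (p $ 3)\<^sup>2 + p $ 1 + p $ 4 ^ 3 = 0"
  by (simp add: Y_hyp_def zero_set_def P_tilde_def peval_simps)

lemma Y_hyp_eqI:
  assumes "p \<in> Y_hyp" "q \<in> Y_hyp" "p $ 1 = q $ 1" "p $ 1 \<noteq> 0"
    and "p $ 3 = q $ 3" "p $ 4 = q $ 4" "p $ 5 = q $ 5"
  shows "p = q"
proof -
  have "(p $ 1)\<^sup>2 * p $ 2 = (p $ 1)\<^sup>2 * q $ 2"
    using assms unfolding Y_hyp_iff by algebra
  then show ?thesis
    using assms by (simp add: vec_eq_5)
qed

text \<open>
  The flows are read off from invariants, such as \<open>y - u\<^sup>2\<close> for \<open>\<tau>\<close>, and from elements whose second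
  derivative vanishes.
\<close>

lemma tau_flow:
  "exp_map s tau p $ 1 = p $ 1" "exp_map s tau p $ 4 = p $ 4" "exp_map s tau p $ 5 = p $ 5 + s"
  "exp_map s tau p $ 3 = p $ 3 - s * p $ 1" "exp_map s tau p $ 2 = p $ 2 + 2 * s * p $ 5 + s\<^sup>2"
proof -
  show "exp_map s tau p $ 1 = p $ 1" "exp_map s tau p $ 4 = p $ 4" and u: "exp_map s tau p $ 5 = p $ 5 + s"
    using tau.peval_exp_map_kernel[of vx s p] tau.peval_exp_map_kernel[of vt s p]
      tau.peval_exp_map_slice[of vu s p] by (simp_all add: tau_Var tau.one peval_simps)
  show "exp_map s tau p $ 3 = p $ 3 - s * p $ 1"
    using tau.peval_exp_map_slice[of vz s p] by (simp add: tau_Var tau.uminus peval_simps)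
  have "tau (vy - vu ^ 2) = 0"
    by (simp add: tau.rules tau_Var)
  from tau.peval_exp_map_kernel[OF this, of s p] show "exp_map s tau p $ 2 = p $ 2 + 2 * s * p $ 5 + s\<^sup>2"
    by (simp add: peval_simps u power2_eq_square algebra_simps)
qed

lemma delta_z_flow:
  "exp_map s delta_z p $ 1 = p $ 1" "exp_map s delta_z p $ 4 = p $ 4"
  "exp_map s delta_z p $ 5 = p $ 5" "exp_map s delta_z p $ 3 = p $ 3 + s * (p $ 1)\<^sup>2"
  using delta_z.peval_exp_map_kernel[of vx s p] delta_z.peval_exp_map_kernel[of vt s p]
    delta_z.peval_exp_map_kernel[of vu s p] delta_z.peval_exp_map_slice[of vz s p]
  by (simp_all add: delta_z_Var delta_z.power2 peval_simps)

lemma delta_t_flow: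
  "exp_map s delta_t p $ 1 = p $ 1" "exp_map s delta_t p $ 3 = p $ 3"
  "exp_map s delta_t p $ 5 = p $ 5" "exp_map s delta_t p $ 4 = p $ 4 + s * (p $ 1)\<^sup>2"
  using delta_t.peval_exp_map_kernel[of vx s p] delta_t.peval_exp_map_kernel[of vz s p]
    delta_t.peval_exp_map_kernel[of vu s p] delta_t.peval_exp_map_slice[of vt s p]
  by (simp_all add: delta_t_Var delta_t.power2 peval_simps)

text \<open>
  Of the terms of the exponential series of \<open>y\<close>, those of order at least two are multiples of \<open>x\<^sup>2\<close>.
\<close>

lemma delta_t_flow_x0:
  assumes "p $ 1 = 0"
  shows "exp_map s delta_t p $ 2 = p $ 2 - 3 * s * (p $ 4)\<^sup>2"
proof -
  have D2: "delta_t (delta_t vy) = - 6 * vt * vx ^ 2"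
    by (simp add: delta_t.rules delta_t_Var algebra_simps)
  have D3: "delta_t (- 6 * vt * vx ^ 2) = - 6 * vx ^ 4"
    by (simp add: delta_t.rules delta_t_Var flip: power_add)
  have D4: "delta_t (- 6 * vx ^ 4) = 0"
    by (simp add: delta_t.rules delta_t_Var numeral_eq_Suc)
  have iter: "(h ^^ 2) f = h (h f)" "(h ^^ 3) f = h (h (h f))" "(h ^^ 4) f = h (h (h (h f)))"
    for h :: "5 mpoly \<Rightarrow> 5 mpoly" and f
    by (simp_all add: eval_nat_numeral)
  have "(\<Sum>k<4. h k) = h 0 + h 1 + h 2 + h 3" for h :: "nat \<Rightarrow> complex"
    by (simp add: eval_nat_numeral)
  moreover have "(delta_t ^^ 2) vy = - 6 * vt * vx ^ 2" "(delta_t ^^ 3) vy = - 6 * vx ^ 4"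
    "(delta_t ^^ 4) vy = 0"
    unfolding iter D2 D3 D4 by simp_all
  ultimately show ?thesis
    using delta_t.exp_series_finite[of 4 vy s p] assms
    by (simp add: delta_t.exp_map_nth delta_t_Var(2) peval_simps)
qed

definition fa :: "complex ^ 5 \<Rightarrow> complex" where "fa p = 1 + p $ 1 * p $ 2 + 2 * p $ 3 * p $ 5"
definition fc :: "complex ^ 5 \<Rightarrow> complex" where "fc p = p $ 3 * p $ 2 - 2 * fa p * p $ 5"

lemma E_flow:
  "exp_map s E_der p $ 2 = p $ 2" "fa (exp_map s E_der p) = fa p" "fc (exp_map s E_der p) = fc p"
  "exp_map s E_der p $ 4 = p $ 4 + s * (fa p * fc p)"
proof -
  show y: "exp_map s E_der p $ 2 = p $ 2"
    using E.peval_exp_map_kernel[of vy s p] by (simp add: E_der_Var peval_simps)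
  have a: "peval va q = fa q" for q
    by (simp add: fa_def peval_simps)
  have c: "peval vc q = fc q" for q
    by (simp add: fc_def fa_def peval_simps)
  show "fa (exp_map s E_der p) = fa p" "fc (exp_map s E_der p) = fc p"
    using E.peval_exp_map_kernel[OF E_va, of s p] E.peval_exp_map_kernel[OF E_vc, of s p]
    unfolding a c by simp_all
  have "E_der (E_der vt) = 0"
    by (simp only: E_vt E.mult E_va E_vc) simp
  from E.peval_exp_map_slice[OF this, of s p] show "exp_map s E_der p $ 4 = p $ 4 + s * (fa p * fc p)"
    unfolding E_vt peval_mult a c by (simp add: peval_simps)
qed

section \<open>The values of \<open>x\<close> on orbits of \<open>E\<close>\<close>

text \<open>
  The left-hand side is the equation of \<open>Y\<close> multiplied by \<open>y\<^sup>2\<close> and rewritten in \<open>y, a, c, t, u\<close>. If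
  \<open>a\<close>, \<open>c\<close> and \<open>y\<close> are nonzero it determines \<open>u\<close> from \<open>t\<close> along an orbit of \<open>E\<close>.
\<close>

lemma Y_relation:
  assumes "p \<in> Y_hyp"
  shows "fa p * (fa p - 1) * p $ 2 + (fc p)\<^sup>2 + 2 * fa p * fc p * p $ 5 + (p $ 2)\<^sup>2 * p $ 4 ^ 3 = 0"
proof -
  have "fa p * (fa p - 1) * p $ 2 + (fc p)\<^sup>2 + 2 * fa p * fc p * p $ 5 + (p $ 2)\<^sup>2 * p $ 4 ^ 3 =
     (p $ 2)\<^sup>2 * ((p $ 1)\<^sup>2 * p $ 2 + 2 * p $ 1 * p $ 3 * p $ 5 + (p $ 3)\<^sup>2 + p $ 1 + p $ 4 ^ 3)"
    unfolding fa_def fc_def by algebra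
  then show ?thesis
    using assms by (simp add: Y_hyp_iff)
qed

lemma complex_cube_root: "\<exists>w::complex. w ^ 3 = r"
proof (cases "r = 0")
  case False
  then have "exp (Ln r / 3) ^ 3 = r"
    by (simp flip: exp_of_nat_mult)
  then show ?thesis ..
qed (auto intro: exI[of _ 0])

text \<open>
  On the orbit \<open>yz = c + 2au\<close> and \<open>xy = a - 1 - 2zu\<close>, so \<open>x = \<xi>\<close> is a quadratic equation for \<open>u\<close>, namely
  \<open>4au\<^sup>2 + 2cu = y(a - 1 - \<xi>y)\<close>. For a root \<open>w\<close> of it, the relation above prescribes the cube of \<open>t\<close>, and
  every value of \<open>t\<close> is reached because \<open>ac \<noteq> 0\<close>.
\<close>

lemma E_orbit_hits:
  assumes p: "p \<in> Y_hyp" and nz: "p $ 2 \<noteq> 0" "fa p \<noteq> 0" "fc p \<noteq> 0"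
  shows "\<exists>s. exp_map s E_der p $ 1 = \<xi>"
proof -
  define y a c where "y = p $ 2" and "a = fa p" and "c = fc p"
  note nz' = nz[folded y_def a_def c_def]
  define d where "d = csqrt (c\<^sup>2 + 4 * a * y * (a - 1 - \<xi> * y))"
  define w where "w = (d - c) / (4 * a)"
  have d2: "d\<^sup>2 = c\<^sup>2 + 4 * a * y * (a - 1 - \<xi> * y)"
    by (simp add: d_def)
  have aw: "4 * a * w = d - c"
    using nz' by (simp add: w_def)
  have "4 * a * (4 * a * w\<^sup>2 + 2 * c * w) = (4 * a * w) * (4 * a * w + 2 * c)"
    by (simp add: power2_eq_square algebra_simps)
  also have "\<dots> = d\<^sup>2 - c\<^sup>2"
    unfolding aw by (simp add: power2_eq_square algebra_simps)
  also have "\<dots> = 4 * a * (y * (a - 1 - \<xi> * y))"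
    by (simp add: d2)
  finally have w: "4 * a * w\<^sup>2 + 2 * c * w = y * (a - 1 - \<xi> * y)"
    using nz' by simp
  obtain T where T: "T ^ 3 = - (a * (a - 1) * y + c\<^sup>2 + 2 * a * c * w) / y\<^sup>2"
    using complex_cube_root by blast
  define q where "q = exp_map ((T - p $ 4) / (a * c)) E_der p"
  have q: "q $ 2 = y" "fa q = a" "fc q = c" "q $ 4 = T" "q \<in> Y_hyp"
    using E_flow[of _ p] nz exp_map_Y[of E_der p] p by (simp_all add: q_def y_def a_def c_def)
  have "2 * a * c * q $ 5 = - (a * (a - 1) * y + c\<^sup>2 + y\<^sup>2 * T ^ 3)"
    using Y_relation[OF q(5)] unfolding q(1-4) by algebra
  also have "\<dots> = 2 * a * c * w"
  proof -
    have "y\<^sup>2 * T ^ 3 = - (a * (a - 1) * y + c\<^sup>2 + 2 * a * c * w)"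
      unfolding T using nz'(1) by simp
    then show ?thesis by algebra
  qed
  finally have u: "q $ 5 = w"
    using nz' by simp
  have z: "q $ 3 * y = c + 2 * a * w"
    using q(3) unfolding fc_def q(1,2) u by (simp add: algebra_simps)
  have x: "q $ 1 * y = a - 1 - 2 * q $ 3 * w"
    using q(2) unfolding fa_def q(1) u by (simp add: algebra_simps)
  have "q $ 1 * y * y = y * (a - 1) - 2 * w * (q $ 3 * y)"
    unfolding x by (simp add: algebra_simps)
  also have "\<dots> = y * (a - 1) - (4 * a * w\<^sup>2 + 2 * c * w)"
    unfolding z by (simp add: algebra_simps power2_eq_square)
  also have "\<dots> = \<xi> * y * y"
    unfolding w by (simp add: algebra_simps)
  finally have "q $ 1 = \<xi>"
    using nz' by simp
  then show ?thesis
    unfolding q_def by blast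
qed

section \<open>Transitivity\<close>

definition G_reaches :: "complex ^ 5 \<Rightarrow> complex ^ 5 \<Rightarrow> bool" where
  "G_reaches p q \<longleftrightarrow> (\<exists>g\<in>exp_group four_derivations. g p = q)"

lemma subgroup_G: "subgroup (exp_group four_derivations) (aut_group UNIV)"
  by (rule subgroup_exp_group) (use four_derivations_lnd in blast)

lemma G_preserves_Y: "g \<in> exp_group four_derivations \<Longrightarrow> g ` Y_hyp = Y_hyp"
  unfolding Y_hyp_def by (rule exp_group_image[OF four_derivations_lnd])

lemma G_reaches_exp: "D \<in> four_derivations \<Longrightarrow> G_reaches p (exp_map s D p)"
  unfolding G_reaches_def by (rule bexI[of _ "exp_map s D"]) (auto intro: exp_map_in_exp_group)

lemma G_reaches_trans:
  assumes "G_reaches p q" "G_reaches q r"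
  shows "G_reaches p r"
proof -
  obtain g where g: "g \<in> exp_group four_derivations" "g p = q"
    using assms(1) unfolding G_reaches_def ..
  obtain h where h: "h \<in> exp_group four_derivations" "h q = r"
    using assms(2) unfolding G_reaches_def ..
  show ?thesis
    unfolding G_reaches_def
    by (rule bexI[OF _ subgroup_aut_UNIV_mult(2)[OF subgroup_G h(1) g(1)]]) (simp add: g h)
qed

lemma G_reaches_same_x:
  assumes p: "p \<in> Y_hyp" and q: "q \<in> Y_hyp" and x: "p $ 1 = q $ 1" "p $ 1 \<noteq> 0"
  shows "G_reaches p q"
proof -
  define p1 where "p1 = exp_map (q $ 5 - p $ 5) tau p"
  define p2 where "p2 = exp_map ((q $ 3 - p1 $ 3) / (p $ 1)\<^sup>2) delta_z p1"
  define p3 where "p3 = exp_map ((q $ 4 - p2 $ 4) / (p $ 1)\<^sup>2) delta_t p2"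
  have p1: "p1 \<in> Y_hyp" "p1 $ 1 = p $ 1" "p1 $ 5 = q $ 5"
    unfolding p1_def by (simp_all add: tau_flow exp_map_Y p)
  have p2: "p2 \<in> Y_hyp" "p2 $ 1 = p $ 1" "p2 $ 5 = q $ 5" "p2 $ 3 = q $ 3"
    unfolding p2_def using x(2) p1 by (simp_all add: delta_z_flow exp_map_Y)
  have p3: "p3 \<in> Y_hyp" "p3 $ 1 = p $ 1" "p3 $ 5 = q $ 5" "p3 $ 3 = q $ 3" "p3 $ 4 = q $ 4"
    unfolding p3_def using x(2) p2 by (simp_all add: delta_t_flow exp_map_Y)
  have "p3 = q"
    by (rule Y_hyp_eqI) (use p3 q x in simp_all)
  moreover have "G_reaches p p1" "G_reaches p1 p2" "G_reaches p2 p3"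
    unfolding p1_def p2_def p3_def by (rule G_reaches_exp; simp)+
  ultimately show ?thesis
    using G_reaches_trans by blast
qed

text \<open>
  Where \<open>x \<noteq> 0\<close>, a good point is chosen directly on the level set of \<open>x\<close>. Where \<open>x = 0\<close> the equation
  becomes \<open>z\<^sup>2 = -t\<^sup>3\<close>, and \<open>\<tau>\<close>, \<open>\<delta>\<^sub>t\<close> move only \<open>u\<close> and \<open>y\<close>. If \<open>t \<noteq> 0\<close> these can be made \<open>0\<close> and \<open>1\<close>, so
  that \<open>a = 1\<close> and \<open>c = z \<noteq> 0\<close>. If \<open>t = z = 0\<close> then \<open>a = 1\<close> and \<open>c = -2u\<close>, and moving along \<open>\<tau>\<close> makes \<open>u\<close>
  and \<open>y\<close> nonzero.
\<close>

lemma G_reaches_generic: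
  assumes p: "p \<in> Y_hyp"
  shows "\<exists>q\<in>Y_hyp. G_reaches p q \<and> q $ 2 \<noteq> 0 \<and> fa q \<noteq> 0 \<and> fc q \<noteq> 0"
proof (cases "p $ 1 = 0")
  case False
  define x where "x = p $ 1"
  obtain T where T: "T ^ 3 = - (2 * x + 1)"
    using complex_cube_root by blast
  define q :: "complex ^ 5" where "q = vector [x, 1 / x, 1, T, 0]"
  have "q \<in> Y_hyp"
    using False T by (simp add: Y_hyp_iff q_def vector_5 power2_eq_square x_def)
  moreover have "q $ 2 \<noteq> 0 \<and> fa q \<noteq> 0 \<and> fc q \<noteq> 0"
    using False by (simp add: fa_def fc_def q_def vector_5 x_def)
  moreover have "G_reaches p q"
    by (rule G_reaches_same_x[OF p \<open>q \<in> Y_hyp\<close>]) (use False in \<open>simp_all add: q_def vector_5 x_def\<close>)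
  ultimately show ?thesis by blast
next
  case x: True
  have zt: "(p $ 3)\<^sup>2 = - (p $ 4 ^ 3)"
    using p x by (simp add: Y_hyp_iff add_eq_0_iff)
  show ?thesis
  proof (cases "p $ 4 = 0")
    case False
    define p1 where "p1 = exp_map (- p $ 5) tau p"
    have p1: "p1 \<in> Y_hyp" "p1 $ 1 = 0" "p1 $ 3 = p $ 3" "p1 $ 4 = p $ 4" "p1 $ 5 = 0"
      unfolding p1_def using p x by (simp_all add: tau_flow exp_map_Y)
    define q where "q = exp_map ((p1 $ 2 - 1) / (3 * (p $ 4)\<^sup>2)) delta_t p1"
    have q: "q \<in> Y_hyp" "q $ 1 = 0" "q $ 3 = p $ 3" "q $ 5 = 0" "q $ 2 = 1"
      unfolding q_def using p1 False by (simp_all add: delta_t_flow delta_t_flow_x0 exp_map_Y field_simps)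
    have "p $ 3 \<noteq> 0"
      using zt False by auto
    then have "q $ 2 \<noteq> 0 \<and> fa q \<noteq> 0 \<and> fc q \<noteq> 0"
      using q by (simp add: fa_def fc_def)
    moreover have "G_reaches p p1" "G_reaches p1 q"
      unfolding p1_def q_def by (rule G_reaches_exp; simp)+
    ultimately show ?thesis
      using q(1) G_reaches_trans by blast
  next
    case t: True
    then have z: "p $ 3 = 0"
      using zt by simp
    \<comment> \<open>The new value of \<open>u\<close>; the new \<open>y\<close> is \<open>e\<^sup>2\<close> plus the invariant \<open>y - u\<^sup>2\<close> and must not vanish.\<close>
    define e :: complex where "e = (if p $ 2 - (p $ 5)\<^sup>2 = - 1 then 2 else 1)"
    define q where "q = exp_map (e - p $ 5) tau p"
    have q: "q \<in> Y_hyp" "q $ 1 = 0" "q $ 3 = 0" "q $ 5 = e" "q $ 2 = p $ 2 - (p $ 5)\<^sup>2 + e\<^sup>2"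
      unfolding q_def using p x z by (simp_all add: tau_flow exp_map_Y power2_eq_square algebra_simps)
    have "e \<noteq> 0" "q $ 2 \<noteq> 0"
      unfolding q(5) by (auto simp: e_def add_eq_0_iff2)
    then have "q $ 2 \<noteq> 0 \<and> fa q \<noteq> 0 \<and> fc q \<noteq> 0"
      using q by (simp add: fa_def fc_def)
    moreover have "G_reaches p q"
      unfolding q_def by (rule G_reaches_exp) simp
    ultimately show ?thesis
      using q(1) by blast
  qed
qed

text \<open>
  A point at which \<open>x\<close>, \<open>y\<close>, \<open>a\<close>, \<open>c\<close> and \<open>E(x)\<close> are nonzero, so that it serves at once for tangent
  vectors and for general position; \<open>u = 0\<close> there simplifies the separation of points.
\<close>

definition base_point :: "complex ^ 5" where "base_point = vector [1, - 3, 1, 1, 0]"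

lemma base_point_nth: "base_point $ 1 = 1" "base_point $ 2 = - 3" "base_point $ 3 = 1"
    "base_point $ 4 = 1" "base_point $ 5 = 0"
  by (simp_all add: base_point_def vector_5)

lemma base_point_Y: "base_point \<in> Y_hyp"
  by (simp add: Y_hyp_iff base_point_nth)

lemma G_reaches_base_point:
  assumes "p \<in> Y_hyp"
  shows "G_reaches p base_point"
proof -
  obtain q where q: "q \<in> Y_hyp" "G_reaches p q" "q $ 2 \<noteq> 0" "fa q \<noteq> 0" "fc q \<noteq> 0"
    using G_reaches_generic[OF assms] by blast
  obtain s where s: "exp_map s E_der q $ 1 = 1"
    using E_orbit_hits[OF q(1,3-5)] by blast
  have "G_reaches (exp_map s E_der q) base_point"
    by (rule G_reaches_same_x) (use s q(1) in \<open>simp_all add: exp_map_Y base_point_Y base_point_nth\<close>)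
  then show ?thesis
    using q(2) G_reaches_exp[of E_der q s] G_reaches_trans by blast
qed

lemma tangents_span_hyperplane_base_point: "tangents_span_hyperplane Y_hyp base_point"
proof -
  let ?S = "orbit_tangents Y_hyp base_point"
  have tangent: "(\<chi> i. peval (D (Var i)) base_point) \<in> ?S" if "D \<in> four_derivations" for D
    using Ga_action_Y[OF that] lnd.exp_map_has_field_derivative[of D] four_derivations_lnd[OF that]
    unfolding orbit_tangents_def by auto
  \<comment> \<open>The direction of \<open>y\<close> is transversal to the hyperplane because \<open>x \<noteq> 0\<close>.\<close>
  define e :: "complex ^ 5" where "e = vector [0, 1, 0, 0, 0]"
  define a b c d :: "complex ^ 5"
    where "a = vector [0, 0, - 1, 0, 1]" and "b = vector [0, - 2, 1, 0, 0]"
      and "c = vector [0, - 3, 0, 1, 0]" and "d = vector [- 9, 0, - 18, 6, - 27 / 2]"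
  have "a \<in> ?S" "b \<in> ?S" "c \<in> ?S" "d \<in> ?S"
  proof -
    have "a = (\<chi> i. peval (tau (Var i)) base_point)" "b = (\<chi> i. peval (delta_z (Var i)) base_point)"
      "c = (\<chi> i. peval (delta_t (Var i)) base_point)" "d = (\<chi> i. peval (E_der (Var i)) base_point)"
      unfolding vec_eq_5
      by (simp_all add: a_def b_def c_def d_def vector_5 tau_Var delta_z_Var delta_t_Var E_der_Var
          peval_simps base_point_nth)
    then show "a \<in> ?S" "b \<in> ?S" "c \<in> ?S" "d \<in> ?S"
      using tangent by auto
  qed
  then have mem: "v \<in> vec.span (insert e ?S)" if "v \<in> {a, b, c, d, e}" for v
    using that by (intro vec.span_base) auto
  have "w \<in> vec.span (insert e ?S)" for w
  proof -
    define i where "i = - w $ 1 / 9"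
    define j where "j = w $ 5 + 27 / 2 * i"
    define k where "k = w $ 4 - 6 * i"
    define l where "l = w $ 3 + 18 * i + j"
    have "w = i *s d + (j *s a + (k *s c + (l *s b + (w $ 2 + 3 * k + 2 * l) *s e)))"
      unfolding vec_eq_5 by (simp add: a_def b_def c_def d_def e_def vector_5 i_def j_def k_def l_def)
    moreover have "\<dots> \<in> vec.span (insert e ?S)"
      by (intro vec.span_add vec.span_scale mem) auto
    ultimately show ?thesis by metis
  qed
  then show ?thesis
    unfolding tangents_span_hyperplane_def by auto
qed

section \<open>Infinite transitivity on the hypersurface\<close>

lemma connects_base_point:
  assumes "p \<in> Y_hyp"
  shows "\<exists>\<gamma>\<in>poly_paths Y_hyp. \<gamma> 1 p = base_point"
proof -
  obtain g where g: "g \<in> exp_group four_derivations" "g p = base_point"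
    using G_reaches_base_point[OF assms] unfolding G_reaches_def ..
  obtain \<gamma> where "\<gamma> \<in> poly_paths Y_hyp" "\<gamma> 1 = g"
    using exp_group_poly_path[OF four_derivations_lnd g(1)] unfolding Y_hyp_def by blast
  then show ?thesis
    using g(2) by blast
qed

text \<open>
  A replica of \<open>\<tau>\<close> whose time vanishes at \<open>q\<close> changes \<open>y - u\<^sup>2\<close> at neither point and \<open>u\<close> only at \<open>p\<close>.
\<close>

lemma connects_separating_y_invariant:
  assumes h: "poly_fun h" "\<And>s p. h (exp_map s tau p) = h p" "h p \<noteq> h q"
    and p: "p $ 5 = 0" and y: "p $ 2 = q $ 2"
  shows "\<exists>p' q'. connects Y_hyp [p, q] [p', q'] \<and> p' $ 2 \<noteq> q' $ 2"
proof -
  have "Ga_action Y_hyp (\<lambda>s r. exp_map (s * (h r - h q)) tau r)"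
    by (rule Ga_action_replica[OF Ga_action_Y]) (auto simp: h(2) intro: poly_fun_intros h(1))
  from connects_Ga[OF this, of "[p, q]" "1 / (h p - h q)"]
  have "connects Y_hyp [p, q] [exp_map 1 tau p, q]"
    using h(3) by (simp add: tau.exp_map_0)
  moreover have "exp_map 1 tau p $ 2 \<noteq> q $ 2"
    using p y by (simp add: tau_flow)
  ultimately show ?thesis by blast
qed

text \<open>
  Move \<open>p\<close> to the base point. If \<open>y\<close> does not separate the points yet, one of \<open>x\<close>, \<open>z + xu\<close>, \<open>t\<close>, \<open>u\<close>
  does. The first three are invariants of \<open>\<tau>\<close>; the case of \<open>u\<close> is reduced to that of \<open>t\<close>.
\<close>

lemma connects_separating_y:
  assumes pq: "p \<in> Y_hyp" "q \<in> Y_hyp" "p \<noteq> q"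
  shows "\<exists>p' q'. connects Y_hyp [p, q] [p', q'] \<and> p' $ 2 \<noteq> q' $ 2"
proof -
  obtain \<gamma> where \<gamma>: "\<gamma> \<in> poly_paths Y_hyp" "\<gamma> 1 p = base_point"
    using connects_base_point[OF pq(1)] by blast
  define q1 where "q1 = \<gamma> 1 q"
  have c1: "connects Y_hyp [p, q] [base_point, q1]"
    using connects_poly_path[OF \<gamma>(1), of "[p, q]" 1] by (simp add: \<gamma>(2) q1_def)
  have q1: "q1 \<in> Y_hyp" "base_point \<noteq> q1"
    using poly_path_closed[OF \<gamma>(1) pq(2)] poly_path_inj_on[OF \<gamma>(1), of 1] pq \<gamma>(2)
    unfolding q1_def inj_on_def by auto
  have "\<exists>p' q'. connects Y_hyp [base_point, q1] [p', q'] \<and> p' $ 2 \<noteq> q' $ 2"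
  proof (cases "base_point $ 2 = q1 $ 2")
    case False
    then show ?thesis using connects_refl by blast
  next
    case y: True
    define Z where "Z r = r $ 3 + r $ 1 * r $ 5" for r :: "complex ^ 5"
    have inv: "poly_fun Z" "Z (exp_map s tau r) = Z r" for s r
      unfolding Z_def by (auto intro!: poly_fun_intros simp: tau_flow algebra_simps)
    consider "base_point $ 1 \<noteq> q1 $ 1" | "Z base_point \<noteq> Z q1" | "base_point $ 4 \<noteq> q1 $ 4"
      | "base_point $ 1 = q1 $ 1" "Z base_point = Z q1" "base_point $ 4 = q1 $ 4" by blast
    then show ?thesis
    proof cases
      case 1
      show ?thesis
        by (rule connects_separating_y_invariant[OF poly_fun_coord _ 1])
          (use y in \<open>simp_all add: tau_flow base_point_nth\<close>)
    next
      case 2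
      show ?thesis
        by (rule connects_separating_y_invariant[OF inv 2]) (use y in \<open>simp_all add: base_point_nth\<close>)
    next
      case 3
      show ?thesis
        by (rule connects_separating_y_invariant[OF poly_fun_coord _ 3])
          (use y in \<open>simp_all add: tau_flow base_point_nth\<close>)
    next
      case 4
      have u: "q1 $ 5 \<noteq> 0"
      proof
        assume "q1 $ 5 = 0"
        then have "base_point = q1"
          using 4 y unfolding vec_eq_5 by (simp add: Z_def base_point_nth)
        then show False using q1(2) by simp
      qed
      \<comment> \<open>Only \<open>u\<close> differs: a replica of \<open>\<delta>\<^sub>t\<close> with factor \<open>u\<close> makes \<open>t\<close> differ, which \<open>\<tau>\<close> leaves alone.\<close>
      have "Ga_action Y_hyp (\<lambda>s r. exp_map (s * r $ 5) delta_t r)"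
        by (rule Ga_action_replica[OF Ga_action_Y]) (auto simp: delta_t_flow intro: poly_fun_intros)
      from connects_Ga[OF this, of "[base_point, q1]" 1]
      have c2: "connects Y_hyp [base_point, q1] [base_point, exp_map (q1 $ 5) delta_t q1]"
        by (simp add: base_point_nth delta_t.exp_map_0)
      define q2 where "q2 = exp_map (q1 $ 5) delta_t q1"
      have q2: "q2 $ 4 \<noteq> base_point $ 4"
        using u 4 by (simp add: q2_def delta_t_flow base_point_nth)
      show ?thesis
      proof (cases "base_point $ 2 = q2 $ 2")
        case False
        then show ?thesis using c2 unfolding q2_def by blast
      next
        case True
        have "\<exists>p' q'. connects Y_hyp [base_point, q2] [p', q'] \<and> p' $ 2 \<noteq> q' $ 2"
          by (rule connects_separating_y_invariant[OF poly_fun_coord _ q2[symmetric]])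
            (use True in \<open>simp_all add: tau_flow base_point_nth\<close>)
        then show ?thesis
          using c2 connects_trans unfolding q2_def by blast
      qed
    qed
  qed
  then show ?thesis
    using c1 connects_trans by blast
qed

text \<open>
  General position for the conditions that \<open>y\<close>, \<open>a\<close>, \<open>c\<close> are nonzero at each point, indexed by the
  diagonal, and that \<open>y\<close> differs at each pair of points.
\<close>

lemma connects_generic:
  assumes ps: "distinct ps" "set ps \<subseteq> Y_hyp"
  shows "\<exists>qs. connects Y_hyp ps qs \<and> inj_on (\<lambda>p. p $ 2) (set qs) \<and>
    (\<forall>q\<in>set qs. q $ 2 \<noteq> 0 \<and> fa q \<noteq> 0 \<and> fc q \<noteq> 0)"
proof -
  let ?k = "length ps"
  define w where "w q = q $ 2 * fa q * fc q" for q
  have w: "poly_fun w"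
    unfolding w_def fc_def fa_def by (intro poly_fun_intros)
  define \<Phi> where "\<Phi> ij qs = (case ij of (i, j) \<Rightarrow>
      if i = j then w (qs ! i) else qs ! i $ 2 - qs ! j $ 2)" for ij :: "nat \<times> nat" and qs
  have poly: "\<exists>Q. \<forall>s. \<Phi> ij (map (\<gamma> s) qs) = poly Q s"
    if ij: "ij \<in> {..<?k} \<times> {..<?k}" and \<gamma>: "\<gamma> \<in> poly_paths Y_hyp"
      and qs: "set qs \<subseteq> Y_hyp" "length qs = ?k" for ij \<gamma> qs
  proof -
    obtain i j where ij': "ij = (i, j)" "i < ?k" "j < ?k"
      using ij by auto
    have curve: "\<exists>Q. \<forall>s. \<gamma> s (qs ! l) $ m = poly Q s" if "l < ?k" for l m
      by (rule poly_path_curve[OF \<gamma>]) (use qs that nth_mem in \<open>auto simp: subset_iff\<close>)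
    obtain Q where Q: "\<forall>s. w (\<gamma> s (qs ! i)) = poly Q s"
      using poly_fun_poly_curve[OF w, of "\<lambda>s. \<gamma> s (qs ! i)"] curve[OF ij'(2)] by blast
    obtain R S where "\<forall>s. \<gamma> s (qs ! i) $ 2 = poly R s" "\<forall>s. \<gamma> s (qs ! j) $ 2 = poly S s"
      using curve ij' by meson
    then obtain T where "\<forall>s. \<gamma> s (qs ! i) $ 2 - \<gamma> s (qs ! j) $ 2 = poly T s"
      by (metis poly_diff)
    with Q show ?thesis
      unfolding \<Phi>_def using ij' qs(2) by (cases "i = j") auto
  qed
  have reach: "\<exists>rs. connects Y_hyp qs rs \<and> \<Phi> ij rs \<noteq> 0"
    if ij: "ij \<in> {..<?k} \<times> {..<?k}" and qs: "connects Y_hyp ps qs" for ij qs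
  proof -
    obtain i j where ij': "ij = (i, j)" "i < ?k" "j < ?k"
      using ij by auto
    have qs': "set qs \<subseteq> Y_hyp" "length qs = ?k" "distinct qs"
      using connectsD[OF qs ps(2)] ps(1) by auto
    then have mem: "qs ! i \<in> Y_hyp" "qs ! j \<in> Y_hyp"
      using ij' nth_mem by (auto simp: subset_iff)
    show ?thesis
    proof (cases "i = j")
      case True
      obtain \<gamma> where \<gamma>: "\<gamma> \<in> poly_paths Y_hyp" "\<gamma> 1 (qs ! i) = base_point"
        using connects_base_point[OF mem(1)] by blast
      have "\<Phi> ij (map (\<gamma> 1) qs) \<noteq> 0"
        using True ij' qs'(2) \<gamma>(2) by (auto simp: \<Phi>_def w_def fa_def fc_def base_point_nth)
      then show ?thesis
        using connects_poly_path[OF \<gamma>(1)] by blast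
    next
      case False
      then have "qs ! i \<noteq> qs ! j"
        using qs' ij' by (simp add: nth_eq_iff_index_eq)
      then obtain p' q' where "connects Y_hyp [qs ! i, qs ! j] [p', q']" "p' $ 2 \<noteq> q' $ 2"
        using connects_separating_y[OF mem] by blast
      then obtain \<gamma> where \<gamma>: "\<gamma> \<in> poly_paths Y_hyp" "\<gamma> 1 (qs ! i) $ 2 \<noteq> \<gamma> 1 (qs ! j) $ 2"
        by (auto simp: connects_def)
      then have "\<Phi> ij (map (\<gamma> 1) qs) \<noteq> 0"
        using False ij' qs'(2) by (simp add: \<Phi>_def)
      then show ?thesis
        using connects_poly_path[OF \<gamma>(1)] by blast
    qed
  qed
  have "\<exists>qs. connects Y_hyp ps qs \<and> (\<forall>ij\<in>{..<?k} \<times> {..<?k}. \<Phi> ij qs \<noteq> 0)"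
    by (rule general_position[OF _ ps(2)]) (simp, fact poly, fact reach)
  then obtain qs where qs: "connects Y_hyp ps qs" "\<forall>ij\<in>{..<?k} \<times> {..<?k}. \<Phi> ij qs \<noteq> 0"
    by blast
  have len: "length qs = ?k"
    using connectsD(2)[OF qs(1) ps(2)] .
  have diag: "w (qs ! i) \<noteq> 0" if "i < ?k" for i
    using bspec[OF qs(2), of "(i, i)"] that by (simp add: \<Phi>_def)
  have off: "qs ! i $ 2 \<noteq> qs ! j $ 2" if "i < ?k" "j < ?k" "i \<noteq> j" for i j
    using bspec[OF qs(2), of "(i, j)"] that by (simp add: \<Phi>_def)
  have "inj_on (\<lambda>p. p $ 2) (set qs)"
    using off len by (auto simp: inj_on_def in_set_conv_nth) metis
  moreover have "\<forall>q\<in>set qs. w q \<noteq> 0"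
    using diag len by (auto simp: in_set_conv_nth)
  ultimately show ?thesis
    using qs(1) unfolding w_def by (intro exI[of _ qs]) auto
qed

text \<open>
  The points of \<open>Y\<close> with \<open>z = t = u = 0\<close> and distinct \<open>x\<close>. The shift of the index keeps \<open>x\<close> away from
  \<open>0\<close>.
\<close>

definition normal_point :: "nat \<Rightarrow> complex ^ 5" where
  "normal_point i = vector [of_nat (Suc i), - 1 / of_nat (Suc i), 0, 0, 0]"

lemma normal_point_Y: "normal_point i \<in> Y_hyp"
proof -
  have "(of_nat (Suc i))\<^sup>2 * (- 1 / of_nat (Suc i)) = - (of_nat (Suc i) :: complex)"
    by (simp add: power2_eq_square del: of_nat_Suc)
  then show ?thesis
    by (simp add: Y_hyp_iff normal_point_def vector_5 del: of_nat_Suc)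
qed

lemma inj_on_indexed:
  assumes "\<forall>i<length ps. h (ps ! i) = (of_nat (Suc i) :: complex)"
  shows "inj_on h (set ps)"
  using assms by (auto simp: inj_on_def in_set_conv_nth)

text \<open>
  Four replicas with invariant factors: \<open>E\<close> with a factor in \<open>y\<close> sets \<open>x\<close>, and then, as \<open>x\<close> separates the
  points, \<open>\<tau>\<close>, \<open>\<delta>\<^sub>z\<close>, \<open>\<delta>\<^sub>t\<close> with factors in \<open>x\<close> set \<open>u\<close>, \<open>z\<close>, \<open>t\<close>. The order matters: \<open>\<tau>\<close> changes \<open>z\<close>,
  but the two later ones keep what has been achieved.
\<close>

lemma connects_normal_points:
  assumes ps: "distinct ps" "set ps \<subseteq> Y_hyp"
  shows "connects Y_hyp ps (map normal_point [0..<length ps])"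
proof -
  let ?k = "length ps"
  obtain qs where qs: "connects Y_hyp ps qs" "inj_on (\<lambda>p. p $ 2) (set qs)"
      "\<forall>q\<in>set qs. q $ 2 \<noteq> 0 \<and> fa q \<noteq> 0 \<and> fc q \<noteq> 0"
    using connects_generic[OF ps] by blast
  have qs': "set qs \<subseteq> Y_hyp" "length qs = ?k" "distinct qs"
    using connectsD[OF qs(1) ps(2)] ps(1) by auto
  have "\<forall>q\<in>set qs. \<exists>s. exp_map s E_der q $ 1 = of_nat (Suc (inv_into {..<?k} ((!) qs) q))"
    using E_orbit_hits qs(3) qs'(1) by blast
  then obtain f where f:
      "\<And>q. q \<in> set qs \<Longrightarrow> exp_map (f q) E_der q $ 1 = of_nat (Suc (inv_into {..<?k} ((!) qs) q))"
    by metis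
  have index: "inv_into {..<?k} ((!) qs) (qs ! i) = i" if "i < ?k" for i
    by (rule inv_into_f_f) (use that qs' in \<open>auto intro: inj_on_nth\<close>)
  define ps1 where "ps1 = map (\<lambda>p. exp_map (f p) E_der p) qs"
  define ps2 where "ps2 = map (\<lambda>p. exp_map (- p $ 5) tau p) ps1"
  define ps3 where "ps3 = map (\<lambda>p. exp_map (- p $ 3 / (p $ 1)\<^sup>2) delta_z p) ps2"
  define ps4 where "ps4 = map (\<lambda>p. exp_map (- p $ 4 / (p $ 1)\<^sup>2) delta_t p) ps3"
  have len: "length ps1 = ?k" "length ps2 = ?k" "length ps3 = ?k" "length ps4 = ?k"
    by (simp_all add: ps1_def ps2_def ps3_def ps4_def qs'(2))
  have x1: "\<forall>i<?k. ps1 ! i $ 1 = of_nat (Suc i)"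
    using f qs'(2) index by (simp add: ps1_def)
  have x2: "\<forall>i<?k. ps2 ! i $ 1 = of_nat (Suc i) \<and> ps2 ! i $ 5 = 0"
    using x1 len by (simp add: ps2_def tau_flow)
  have x3: "\<forall>i<?k. ps3 ! i $ 1 = of_nat (Suc i) \<and> ps3 ! i $ 5 = 0 \<and> ps3 ! i $ 3 = 0"
    using x2 len by (simp add: ps3_def delta_z_flow del: of_nat_Suc)
  have x4: "\<forall>i<?k. ps4 ! i $ 1 = of_nat (Suc i) \<and> ps4 ! i $ 5 = 0 \<and> ps4 ! i $ 3 = 0 \<and> ps4 ! i $ 4 = 0"
    using x3 len by (simp add: ps4_def delta_t_flow del: of_nat_Suc)
  have "connects Y_hyp qs ps1"
    unfolding ps1_def
    by (rule connects_independent_times[OF Ga_action_Y poly_fun_coord[of 2] _ qs(2)]) (simp_all add: E_flow)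
  moreover have "connects Y_hyp ps1 ps2"
    unfolding ps2_def
    by (rule connects_independent_times[OF Ga_action_Y poly_fun_coord[of 1] _ inj_on_indexed])
      (use x1 len in \<open>simp_all add: tau_flow\<close>)
  moreover have "connects Y_hyp ps2 ps3"
    unfolding ps3_def
    by (rule connects_independent_times[OF Ga_action_Y poly_fun_coord[of 1] _ inj_on_indexed])
      (use x2 len in \<open>simp_all add: delta_z_flow\<close>)
  moreover have "connects Y_hyp ps3 ps4"
    unfolding ps4_def
    by (rule connects_independent_times[OF Ga_action_Y poly_fun_coord[of 1] _ inj_on_indexed])
      (use x3 len in \<open>simp_all add: delta_t_flow\<close>)
  ultimately have c: "connects Y_hyp ps ps4"
    using qs(1) connects_trans by blast
  have "ps4 = map normal_point [0..<?k]"
  proof (rule nth_equalityI)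
    fix i assume "i < length ps4"
    then have i: "i < ?k" by (simp add: len)
    have "ps4 ! i \<in> Y_hyp"
      using connectsD(1)[OF c ps(2)] i len(4) by (metis nth_mem subsetD)
    moreover have "normal_point i $ 1 = of_nat (Suc i)" "normal_point i $ 3 = 0"
      "normal_point i $ 4 = 0" "normal_point i $ 5 = 0"
      by (simp_all add: normal_point_def vector_5)
    ultimately have "ps4 ! i = normal_point i"
      using x4 i by (intro Y_hyp_eqI normal_point_Y) (auto simp del: of_nat_Suc)
    then show "ps4 ! i = map normal_point [0..<?k] ! i"
      using i by simp
  qed (simp add: len)
  then show ?thesis
    using c by simp
qed

section \<open>The cylinder over the Russell cubic\<close>

abbreviation cylinder :: "(complex ^ 5) set" where
  "cylinder \<equiv> times_A1 russell_cubic"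

lemma vector_4:
  "(vector [a, b, c, d] :: 'a::zero ^ 4) $ 1 = a" "(vector [a, b, c, d] :: 'a::zero ^ 4) $ 2 = b"
  "(vector [a, b, c, d] :: 'a::zero ^ 4) $ 3 = c" "(vector [a, b, c, d] :: 'a::zero ^ 4) $ 4 = d"
  by (simp_all add: vector_def)

lemma cylinder_iff: "p \<in> cylinder \<longleftrightarrow> (p $ 1)\<^sup>2 * p $ 2 + (p $ 3)\<^sup>2 + p $ 1 + p $ 4 ^ 3 = 0"
  by (simp add: times_A1_def russell_cubic_def zero_set_def peval_simps vector_4)

definition Theta :: "complex ^ 5 \<Rightarrow> complex ^ 5" where
  "Theta p = vector [p $ 1, p $ 2 + (p $ 5)\<^sup>2, p $ 3 - p $ 1 * p $ 5, p $ 4, p $ 5]"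

definition Theta_inv :: "complex ^ 5 \<Rightarrow> complex ^ 5" where
  "Theta_inv p = vector [p $ 1, p $ 2 - (p $ 5)\<^sup>2, p $ 3 + p $ 1 * p $ 5, p $ 4, p $ 5]"

lemma Theta_nth: "Theta p $ 1 = p $ 1" "Theta p $ 2 = p $ 2 + (p $ 5)\<^sup>2"
    "Theta p $ 3 = p $ 3 - p $ 1 * p $ 5" "Theta p $ 4 = p $ 4" "Theta p $ 5 = p $ 5"
  by (simp_all add: Theta_def vector_5)

lemma Theta_inv_nth: "Theta_inv p $ 1 = p $ 1" "Theta_inv p $ 2 = p $ 2 - (p $ 5)\<^sup>2"
    "Theta_inv p $ 3 = p $ 3 + p $ 1 * p $ 5" "Theta_inv p $ 4 = p $ 4" "Theta_inv p $ 5 = p $ 5"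
  by (simp_all add: Theta_inv_def vector_5)

lemma Theta_inverse: "Theta_inv (Theta p) = p" "Theta (Theta_inv p) = p"
  by (simp_all add: vec_eq_5 Theta_nth Theta_inv_nth)

lemma poly_fun_Theta: "poly_fun (\<lambda>p. Theta p $ i)" "poly_fun (\<lambda>p. Theta_inv p $ i)"
  using exhaust_5[of i] by (auto simp: Theta_nth Theta_inv_nth intro!: poly_fun_intros)

lemma Theta_Y: "Theta p \<in> Y_hyp \<longleftrightarrow> p \<in> cylinder"
proof -
  have "(Theta p $ 1)\<^sup>2 * Theta p $ 2 + 2 * Theta p $ 1 * Theta p $ 3 * Theta p $ 5 +
      (Theta p $ 3)\<^sup>2 + Theta p $ 1 + Theta p $ 4 ^ 3 =
    (p $ 1)\<^sup>2 * p $ 2 + (p $ 3)\<^sup>2 + p $ 1 + p $ 4 ^ 3"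
    unfolding Theta_nth by algebra
  then show ?thesis
    unfolding Y_hyp_iff cylinder_iff by simp
qed

lemma Theta_inv_cylinder: "q \<in> Y_hyp \<Longrightarrow> Theta_inv q \<in> cylinder"
  by (simp flip: Theta_Y add: Theta_inverse)

lemma infinitely_transitive_cylinder: "infinitely_transitive (SAut cylinder) cylinder"
proof (rule infinitely_transitiveI)
  fix ps :: "(complex ^ 5) list"
  assume ps: "distinct ps" "set ps \<subseteq> cylinder"
  have "distinct (map Theta ps)" "set (map Theta ps) \<subseteq> Y_hyp"
    using ps inj_on_inverseI[of "set ps" Theta_inv Theta] by (auto simp: distinct_map Theta_Y Theta_inverse)
  from connects_normal_points[OF this]
  have "connects Y_hyp (map Theta ps) (map normal_point [0..<length ps])"
    by simp
  then have "connects cylinder (map Theta_inv (map Theta ps))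
      (map Theta_inv (map normal_point [0..<length ps]))"
    by (rule connects_conjugate[where H = Theta, rotated -1])
      (simp_all add: poly_fun_Theta Theta_inv_cylinder Theta_Y Theta_inverse)
  then show "connects cylinder ps ((\<lambda>k. map Theta_inv (map normal_point [0..<k])) (length ps))"
    by (simp add: Theta_inverse o_def)
qed

lemma tangents_span_hyperplane_Y:
  assumes q: "q \<in> Y_hyp"
  shows "tangents_span_hyperplane Y_hyp q"
proof -
  let ?G = "exp_group four_derivations"
  obtain g where g: "g \<in> ?G" "g q = base_point"
    using G_reaches_base_point[OF q] unfolding G_reaches_def ..
  obtain h where h: "h \<in> ?G" "\<And>p. h (g p) = p" "\<And>p. g (h p) = p"
    using subgroup_aut_UNIV_inverse[OF subgroup_G g(1)] by metis
  have poly: "poly_fun (\<lambda>p. f p $ i)" if f: "f \<in> ?G" for f i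
  proof -
    obtain k where k: "\<And>i. poly_fun (\<lambda>p. k p $ i)" "\<And>p. f p = k p"
      using aut_groupD(7)[OF subgroup.mem_carrier[OF subgroup_G f]] unfolding regular_on_iff by auto
    show ?thesis
      unfolding k(2) by (rule k(1))
  qed
  have maps: "f p \<in> Y_hyp" if "f \<in> ?G" "p \<in> Y_hyp" for f p
    using G_preserves_Y[OF that(1)] that(2) by blast
  have "tangents_span_hyperplane Y_hyp (h base_point)"
    by (rule tangents_span_hyperplane_transport[where H = g])
      (use poly maps g(1) h base_point_Y tangents_span_hyperplane_base_point in auto)
  then show ?thesis
    using h(2)[of q] by (simp add: g(2))
qed

text \<open>
  The tangent spaces are proper because the gradient of \<open>x\<^sup>2y + z\<^sup>2 + x + t\<^sup>3\<close> vanishes nowhere: its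
  \<open>y\<close>-component is \<open>x\<^sup>2\<close>, and where \<open>x = 0\<close> its \<open>x\<close>-component is \<open>1\<close>.
\<close>

lemma flexible_cylinder: "flexible cylinder"
proof (rule flexibleI)
  fix q assume q: "q \<in> cylinder"
  have "tangents_span_hyperplane cylinder (Theta_inv (Theta q))"
    by (rule tangents_span_hyperplane_transport[where H = Theta and V = Y_hyp])
      (use q in \<open>simp_all add: poly_fun_Theta Theta_inv_cylinder Theta_Y Theta_inverse
        tangents_span_hyperplane_Y\<close>)
  then show "tangents_span_hyperplane cylinder q"
    by (simp add: Theta_inverse)
next
  fix q :: "complex ^ 5"
  let ?P = "vx * vx * vy + vz * vz + vx + vt * vt * vt"
  have grad: "(\<Sum>i\<in>UNIV. peval (pdiff i ?P) q * v $ i) = 0" if "v \<in> tangent_space cylinder q" for v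
  proof -
    have "\<forall>p\<in>cylinder. peval ?P p = 0"
      by (simp add: cylinder_iff peval_simps power2_eq_square power3_eq_cube)
    then show ?thesis
      using that unfolding tangent_space_def by blast
  qed
  have partial: "peval (pdiff j ?P) q = 0" if "tangent_space cylinder q = UNIV" for j
    using grad[of "axis j 1"] that by (simp add: axis_def if_distrib[of "(*) _"] cong: if_cong)
  show "tangent_space cylinder q \<noteq> UNIV"
  proof
    assume "tangent_space cylinder q = UNIV"
    from partial[OF this, of 1] partial[OF this, of 2]
    have "2 * q $ 1 * q $ 2 + 1 = 0" "q $ 1 * q $ 1 = 0"
      by (simp_all add: pdiff_add pdiff_mult pdiff_Var peval_simps)
    then show False by simp
  qed
qed

theorem theorem1p4:
  fixes G :: "(complex ^ 5 \<Rightarrow> complex ^ 5) set"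
  assumes G_def: "G = exp_group {tau, delta_z, delta_t, E_der}"
  shows "(\<forall>D\<in>{tau, delta_z, delta_t, E_der}. C_derivation D \<and> locally_nilpotent D)
    \<and> subgroup G (aut_group UNIV)
    \<and> (\<forall>g\<in>G. g ` Y_hyp = Y_hyp)
    \<and> transitive_action ((aut_group UNIV)\<lparr>carrier := G\<rparr>) Y_hyp (\<lambda>g. restrict g Y_hyp)
    \<and> flexible (times_A1 russell_cubic)
    \<and> infinitely_transitive (SAut (times_A1 russell_cubic)) (times_A1 russell_cubic)"
proof (intro conjI ballI)
  fix D assume "D \<in> four_derivations"
  then show "C_derivation D" "locally_nilpotent D"
    using four_derivations_lnd unfolding lnd_def lnd_axioms_def C_deriv_def by auto
next
  show "transitive_action ((aut_group UNIV)\<lparr>carrier := G\<rparr>) Y_hyp (\<lambda>g. restrict g Y_hyp)"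
    unfolding G_def
    by (rule transitive_actionI[OF subgroup_G G_preserves_Y, where q = base_point])
      (use G_reaches_base_point in \<open>auto simp: G_reaches_def\<close>)
qed (use subgroup_G G_preserves_Y flexible_cylinder infinitely_transitive_cylinder G_def in auto)

end
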